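(* Let $\mathbb{E}$ be a finitely complete category which is an $\mathrm{Equ}$-saturating Gumm category. Then for every object $X$ of $\mathbb{E}$, the fiber $\mathsf{Cat}_X\mathbb{E}$ is an $\mathrm{Equ}$-saturating category as well.
   Context: A Gumm category is a finitely complete category in which the Shifting Lemma holds: given any internal equivalence relations $R,S,T$ on an object $X$ with $R\cap S\subset T$, and (generalized) elements $x,y,x',y'$ of $X$ with $x\,S\,y$, $x'\,S\,y'$, $x\,R\,x'$, $y\,R\,y'$ and $x\,T\,x'$, one has $y\,T\,y'$. $\mathsf{Cat}_X\mathbb{E}$ is the category of internal categories in $\mathbb{E}$ with object of objects $X$ and internal functors that are the identity on $X$. In a finitely complete category, a monomorphism $u:U\rightarrowtail X$ is saturated with respect to an internal equivalence relation $T$ on $X$ when the square formed by $u^{-1}T\to T$, $u$ and the projections $d_0$ (from $u^{-1}T$ to $U$ and from $T$ to $X$) is a pullback, where $u^{-1}T$ is the inverse image of $T$ along $u$. A finitely complete category is $\mathrm{Equ}$-saturating when, for any monomorphism $u:U\rightarrowtail X$ and any internal equivalence relation $S$ on $U$, among the internal equivalence relations $T$ on $X$ such that $u$ is saturated with respect to $T$ and $u^{-1}T\subset S$, there is a largest one. *)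

theory Defs
  imports Main
begin

section \<open>Categories and finite limits\<close>

record ('o, 'm) cat =
  Obj :: "'o set"
  Arr :: "'m set"
  Dom :: "'m \<Rightarrow> 'o"
  Cod :: "'m \<Rightarrow> 'o"
  Ide :: "'o \<Rightarrow> 'm"
  Comp :: "'m \<Rightarrow> 'm \<Rightarrow> 'm"  (infixl "\<cdot>\<index>" 70)

definition hom :: "('o, 'm) cat \<Rightarrow> 'o \<Rightarrow> 'o \<Rightarrow> 'm set" where
  "hom C A B = {f \<in> Arr C. Dom C f = A \<and> Cod C f = B}"

text \<open>\<open>g \<cdot> f\<close> is \<open>f\<close> followed by \<open>g\<close>; it is unspecified on non-composable arrows.\<close>

locale category =
  fixes C :: "('o, 'm) cat" (structure)
  assumes Dom_Obj: "f \<in> Arr C \<Longrightarrow> Dom C f \<in> Obj C"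
    and Cod_Obj: "f \<in> Arr C \<Longrightarrow> Cod C f \<in> Obj C"
    and Ide_hom: "A \<in> Obj C \<Longrightarrow> Ide C A \<in> hom C A A"
    and Comp_hom: "f \<in> hom C A B \<Longrightarrow> g \<in> hom C B D \<Longrightarrow> g \<cdot> f \<in> hom C A D"
    and Comp_Ide: "f \<in> hom C A B \<Longrightarrow> f \<cdot> Ide C A = f"
    and Ide_Comp: "f \<in> hom C A B \<Longrightarrow> Ide C B \<cdot> f = f"
    and Comp_assoc: "f \<in> hom C A B \<Longrightarrow> g \<in> hom C B D \<Longrightarrow> h \<in> hom C D K \<Longrightarrow>
        h \<cdot> (g \<cdot> f) = (h \<cdot> g) \<cdot> f"

definition monic :: "('o, 'm) cat \<Rightarrow> 'm \<Rightarrow> bool" where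
  "monic C u \<longleftrightarrow> u \<in> Arr C \<and>
     (\<forall>Z\<in>Obj C. \<forall>g\<in>hom C Z (Dom C u). \<forall>h\<in>hom C Z (Dom C u).
        u \<cdot>\<^bsub>C\<^esub> g = u \<cdot>\<^bsub>C\<^esub> h \<longrightarrow> g = h)"

text \<open>A diagram is a graph homomorphism from a graph with vertices \<open>V\<close>, edges \<open>E\<close>, source \<open>s\<close>
  and target \<open>t\<close> into the underlying graph of \<open>C\<close>; every functor from a small category
  is such a diagram, with the same cones.\<close>

definition is_diagram :: "('o, 'm) cat \<Rightarrow> 'v set \<Rightarrow> 'e set \<Rightarrow> ('e \<Rightarrow> 'v) \<Rightarrow> ('e \<Rightarrow> 'v) \<Rightarrow>
    ('v \<Rightarrow> 'o) \<Rightarrow> ('e \<Rightarrow> 'm) \<Rightarrow> bool" where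
  "is_diagram C V E s t D F \<longleftrightarrow> (\<forall>v\<in>V. D v \<in> Obj C) \<and>
     (\<forall>e\<in>E. s e \<in> V \<and> t e \<in> V \<and> F e \<in> hom C (D (s e)) (D (t e)))"

definition is_cone :: "('o, 'm) cat \<Rightarrow> 'v set \<Rightarrow> 'e set \<Rightarrow> ('e \<Rightarrow> 'v) \<Rightarrow> ('e \<Rightarrow> 'v) \<Rightarrow>
    ('v \<Rightarrow> 'o) \<Rightarrow> ('e \<Rightarrow> 'm) \<Rightarrow> 'o \<Rightarrow> ('v \<Rightarrow> 'm) \<Rightarrow> bool" where
  "is_cone C V E s t D F L p \<longleftrightarrow> L \<in> Obj C \<and> (\<forall>v\<in>V. p v \<in> hom C L (D v)) \<and>
     (\<forall>e\<in>E. F e \<cdot>\<^bsub>C\<^esub> p (s e) = p (t e))"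

definition is_limit :: "('o, 'm) cat \<Rightarrow> 'v set \<Rightarrow> 'e set \<Rightarrow> ('e \<Rightarrow> 'v) \<Rightarrow> ('e \<Rightarrow> 'v) \<Rightarrow>
    ('v \<Rightarrow> 'o) \<Rightarrow> ('e \<Rightarrow> 'm) \<Rightarrow> 'o \<Rightarrow> ('v \<Rightarrow> 'm) \<Rightarrow> bool" where
  "is_limit C V E s t D F L p \<longleftrightarrow> is_cone C V E s t D F L p \<and>
     (\<forall>L' p'. is_cone C V E s t D F L' p' \<longrightarrow>
        (\<exists>!h. h \<in> hom C L' L \<and> (\<forall>v\<in>V. p v \<cdot>\<^bsub>C\<^esub> h = p' v)))"

locale finitely_complete_category = category +
  assumes finite_limits: "finite (V :: nat set) \<Longrightarrow> finite (E :: nat set) \<Longrightarrow>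
      is_diagram C V E s t D F \<Longrightarrow> \<exists>L p. is_limit C V E s t D F L p"

text \<open>\<open>is_pullback C p q f g\<close>: the square \<open>f \<cdot> p = g \<cdot> q\<close> is a pullback.\<close>

definition is_pullback :: "('o, 'm) cat \<Rightarrow> 'm \<Rightarrow> 'm \<Rightarrow> 'm \<Rightarrow> 'm \<Rightarrow> bool" where
  "is_pullback C p q f g \<longleftrightarrow> f \<in> Arr C \<and> g \<in> Arr C \<and> Cod C f = Cod C g \<and>
     p \<in> hom C (Dom C p) (Dom C f) \<and> q \<in> hom C (Dom C p) (Dom C g) \<and>
     f \<cdot>\<^bsub>C\<^esub> p = g \<cdot>\<^bsub>C\<^esub> q \<and>
     (\<forall>Z\<in>Obj C. \<forall>a\<in>hom C Z (Dom C f). \<forall>b\<in>hom C Z (Dom C g).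
        f \<cdot>\<^bsub>C\<^esub> a = g \<cdot>\<^bsub>C\<^esub> b \<longrightarrow>
        (\<exists>!w. w \<in> hom C Z (Dom C p) \<and> p \<cdot>\<^bsub>C\<^esub> w = a \<and> q \<cdot>\<^bsub>C\<^esub> w = b))"


section \<open>Internal relations\<close>

text \<open>An internal relation \<open>R\<close> on \<open>X\<close> is a jointly monic pair of arrows \<open>(d\<^sub>0, d\<^sub>1)\<close> from a
  common domain to \<open>X\<close>.\<close>

abbreviation apex :: "('o, 'm) cat \<Rightarrow> 'm \<times> 'm \<Rightarrow> 'o" where
  "apex C R \<equiv> Dom C (fst R)"

definition is_relation :: "('o, 'm) cat \<Rightarrow> 'o \<Rightarrow> 'm \<times> 'm \<Rightarrow> bool" where
  "is_relation C X R \<longleftrightarrow> fst R \<in> hom C (apex C R) X \<and> snd R \<in> hom C (apex C R) X \<and>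
     (\<forall>Z\<in>Obj C. \<forall>g\<in>hom C Z (apex C R). \<forall>h\<in>hom C Z (apex C R).
        fst R \<cdot>\<^bsub>C\<^esub> g = fst R \<cdot>\<^bsub>C\<^esub> h \<and> snd R \<cdot>\<^bsub>C\<^esub> g = snd R \<cdot>\<^bsub>C\<^esub> h \<longrightarrow> g = h)"

text \<open>\<open>related C R x y\<close>: the generalized elements \<open>x\<close>, \<open>y\<close> (of common domain) satisfy \<open>x R y\<close>.\<close>

definition related :: "('o, 'm) cat \<Rightarrow> 'm \<times> 'm \<Rightarrow> 'm \<Rightarrow> 'm \<Rightarrow> bool" where
  "related C R x y \<longleftrightarrow> (\<exists>h\<in>hom C (Dom C x) (apex C R).
     fst R \<cdot>\<^bsub>C\<^esub> h = x \<and> snd R \<cdot>\<^bsub>C\<^esub> h = y)"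

definition internal_equivalence :: "('o, 'm) cat \<Rightarrow> 'o \<Rightarrow> 'm \<times> 'm \<Rightarrow> bool" where
  "internal_equivalence C X R \<longleftrightarrow> is_relation C X R \<and>
     (\<forall>Z\<in>Obj C. equiv (hom C Z X) {(x, y). x \<in> hom C Z X \<and> y \<in> hom C Z X \<and> related C R x y})"

text \<open>Inclusion of relations as subobjects of \<open>X \<times> X\<close>.\<close>

definition rel_le :: "('o, 'm) cat \<Rightarrow> 'm \<times> 'm \<Rightarrow> 'm \<times> 'm \<Rightarrow> bool" where
  "rel_le C R S \<longleftrightarrow> (\<exists>h\<in>hom C (apex C R) (apex C S).
     fst S \<cdot>\<^bsub>C\<^esub> h = fst R \<and> snd S \<cdot>\<^bsub>C\<^esub> h = snd R)"

text \<open>\<open>I\<close> represents \<open>R \<inter> S\<close>: its generalized elements are the pairs related by both.\<close>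

definition is_intersection :: "('o, 'm) cat \<Rightarrow> 'o \<Rightarrow> 'm \<times> 'm \<Rightarrow> 'm \<times> 'm \<Rightarrow> 'm \<times> 'm \<Rightarrow> bool" where
  "is_intersection C X R S I \<longleftrightarrow> is_relation C X I \<and>
     (\<forall>Z\<in>Obj C. \<forall>x\<in>hom C Z X. \<forall>y\<in>hom C Z X.
        related C I x y \<longleftrightarrow> related C R x y \<and> related C S x y)"

locale gumm_category = finitely_complete_category +
  assumes shifting_lemma:
    "\<lbrakk>X \<in> Obj C;
      internal_equivalence C X R; internal_equivalence C X S; internal_equivalence C X T;
      \<exists>I. is_intersection C X R S I \<and> rel_le C I T;
      Z \<in> Obj C; x \<in> hom C Z X; y \<in> hom C Z X; x' \<in> hom C Z X; y' \<in> hom C Z X;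
      related C S x y; related C S x' y'; related C R x x'; related C R y y';
      related C T x x'\<rbrakk> \<Longrightarrow> related C T y y'"


section \<open>Saturation\<close>

text \<open>\<open>is_inverse_image C u T W k\<close>: \<open>W\<close>, together with the comparison arrow \<open>k : W \<rightarrow> T\<close>, is the
  pullback of \<open>T\<close> (as a relation on the codomain of \<open>u\<close>) along \<open>u \<times> u\<close>.\<close>

definition is_inverse_image ::
    "('o, 'm) cat \<Rightarrow> 'm \<Rightarrow> 'm \<times> 'm \<Rightarrow> 'm \<times> 'm \<Rightarrow> 'm \<Rightarrow> bool" where
  "is_inverse_image C u T W k \<longleftrightarrow> is_relation C (Dom C u) W \<and>
     k \<in> hom C (apex C W) (apex C T) \<and>
     fst T \<cdot>\<^bsub>C\<^esub> k = u \<cdot>\<^bsub>C\<^esub> fst W \<and> snd T \<cdot>\<^bsub>C\<^esub> k = u \<cdot>\<^bsub>C\<^esub> snd W \<and>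
     (\<forall>Z\<in>Obj C. \<forall>a\<in>hom C Z (Dom C u). \<forall>b\<in>hom C Z (Dom C u). \<forall>t\<in>hom C Z (apex C T).
        fst T \<cdot>\<^bsub>C\<^esub> t = u \<cdot>\<^bsub>C\<^esub> a \<and> snd T \<cdot>\<^bsub>C\<^esub> t = u \<cdot>\<^bsub>C\<^esub> b \<longrightarrow>
        (\<exists>!w. w \<in> hom C Z (apex C W) \<and>
           fst W \<cdot>\<^bsub>C\<^esub> w = a \<and> snd W \<cdot>\<^bsub>C\<^esub> w = b \<and> k \<cdot>\<^bsub>C\<^esub> w = t))"

text \<open>Inverse images exist in a finitely complete category and are unique up to isomorphism, so
  it does not matter which one is used below.\<close>

definition saturated :: "('o, 'm) cat \<Rightarrow> 'm \<Rightarrow> 'm \<times> 'm \<Rightarrow> bool" where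
  "saturated C u T \<longleftrightarrow> (\<exists>W k. is_inverse_image C u T W k \<and> is_pullback C (fst W) k u (fst T))"

definition inverse_image_le :: "('o, 'm) cat \<Rightarrow> 'm \<Rightarrow> 'm \<times> 'm \<Rightarrow> 'm \<times> 'm \<Rightarrow> bool" where
  "inverse_image_le C u T S \<longleftrightarrow> (\<exists>W k. is_inverse_image C u T W k \<and> rel_le C W S)"

definition saturating_relations ::
    "('o, 'm) cat \<Rightarrow> 'm \<Rightarrow> 'm \<times> 'm \<Rightarrow> ('m \<times> 'm) set" where
  "saturating_relations C u S = {T. internal_equivalence C (Cod C u) T \<and>
     saturated C u T \<and> inverse_image_le C u T S}"

locale equ_saturating_category = finitely_complete_category +
  assumes equ_saturating: "monic C u \<Longrightarrow> internal_equivalence C (Dom C u) S \<Longrightarrow>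
      \<exists>T\<in>saturating_relations C u S. \<forall>T'\<in>saturating_relations C u S. rel_le C T' T"


section \<open>Internal categories\<close>

text \<open>\<open>cmp\<close> is an arrow on the object of composable pairs, i.e. a (chosen) pullback of \<open>tgt\<close> along
  \<open>src\<close>; a composable pair lists the arrow to be applied first as its first component.\<close>

record ('o, 'm) icat =
  iobj :: 'o
  imor :: 'o
  src :: 'm
  tgt :: 'm
  idn :: 'm
  cmp :: 'm

definition composable_pairs :: "('o, 'm) cat \<Rightarrow> ('o, 'm) icat \<Rightarrow> 'm \<times> 'm" where
  "composable_pairs C A = (SOME (p, q). is_pullback C p q (tgt A) (src A))"

abbreviation pairs1 :: "('o, 'm) cat \<Rightarrow> ('o, 'm) icat \<Rightarrow> 'm" where
  "pairs1 C A \<equiv> fst (composable_pairs C A)"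

abbreviation pairs2 :: "('o, 'm) cat \<Rightarrow> ('o, 'm) icat \<Rightarrow> 'm" where
  "pairs2 C A \<equiv> snd (composable_pairs C A)"

text \<open>The internal composite of generalized elements \<open>f\<close>, \<open>g\<close> of \<open>imor A\<close> with
  \<open>tgt A \<cdot> f = src A \<cdot> g\<close>.\<close>

definition icomp :: "('o, 'm) cat \<Rightarrow> ('o, 'm) icat \<Rightarrow> 'm \<Rightarrow> 'm \<Rightarrow> 'm" where
  "icomp C A f g = cmp A \<cdot>\<^bsub>C\<^esub>
     (THE w. w \<in> hom C (Dom C f) (Dom C (pairs1 C A)) \<and>
             pairs1 C A \<cdot>\<^bsub>C\<^esub> w = f \<and> pairs2 C A \<cdot>\<^bsub>C\<^esub> w = g)"

definition internal_category :: "('o, 'm) cat \<Rightarrow> ('o, 'm) icat \<Rightarrow> bool" where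
  "internal_category C A \<longleftrightarrow> iobj A \<in> Obj C \<and> imor A \<in> Obj C \<and>
     src A \<in> hom C (imor A) (iobj A) \<and> tgt A \<in> hom C (imor A) (iobj A) \<and>
     idn A \<in> hom C (iobj A) (imor A) \<and> cmp A \<in> hom C (Dom C (pairs1 C A)) (imor A) \<and>
     src A \<cdot>\<^bsub>C\<^esub> idn A = Ide C (iobj A) \<and> tgt A \<cdot>\<^bsub>C\<^esub> idn A = Ide C (iobj A) \<and>
     src A \<cdot>\<^bsub>C\<^esub> cmp A = src A \<cdot>\<^bsub>C\<^esub> pairs1 C A \<and>
     tgt A \<cdot>\<^bsub>C\<^esub> cmp A = tgt A \<cdot>\<^bsub>C\<^esub> pairs2 C A \<and>
     (\<forall>Z\<in>Obj C. \<forall>f\<in>hom C Z (imor A).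
        icomp C A (idn A \<cdot>\<^bsub>C\<^esub> (src A \<cdot>\<^bsub>C\<^esub> f)) f = f \<and>
        icomp C A f (idn A \<cdot>\<^bsub>C\<^esub> (tgt A \<cdot>\<^bsub>C\<^esub> f)) = f) \<and>
     (\<forall>Z\<in>Obj C. \<forall>f\<in>hom C Z (imor A). \<forall>g\<in>hom C Z (imor A). \<forall>h\<in>hom C Z (imor A).
        tgt A \<cdot>\<^bsub>C\<^esub> f = src A \<cdot>\<^bsub>C\<^esub> g \<and> tgt A \<cdot>\<^bsub>C\<^esub> g = src A \<cdot>\<^bsub>C\<^esub> h \<longrightarrow>
        icomp C A (icomp C A f g) h = icomp C A f (icomp C A g h))"

definition internal_functor ::
    "('o, 'm) cat \<Rightarrow> ('o, 'm) icat \<Rightarrow> ('o, 'm) icat \<Rightarrow> 'm \<Rightarrow> 'm \<Rightarrow> bool" where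
  "internal_functor C A B f0 f1 \<longleftrightarrow>
     f0 \<in> hom C (iobj A) (iobj B) \<and> f1 \<in> hom C (imor A) (imor B) \<and>
     src B \<cdot>\<^bsub>C\<^esub> f1 = f0 \<cdot>\<^bsub>C\<^esub> src A \<and> tgt B \<cdot>\<^bsub>C\<^esub> f1 = f0 \<cdot>\<^bsub>C\<^esub> tgt A \<and>
     f1 \<cdot>\<^bsub>C\<^esub> idn A = idn B \<cdot>\<^bsub>C\<^esub> f0 \<and>
     f1 \<cdot>\<^bsub>C\<^esub> cmp A = icomp C B (f1 \<cdot>\<^bsub>C\<^esub> pairs1 C A) (f1 \<cdot>\<^bsub>C\<^esub> pairs2 C A)"

text \<open>The fiber \<open>Cat\<^sub>X C\<close>. An arrow \<open>A \<rightarrow> B\<close> is a triple \<open>(A, f, B)\<close> where \<open>f\<close> is the arrow part of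
  an internal functor whose object part is the identity on \<open>X\<close>.\<close>

definition cat_fiber :: "('o, 'm) cat \<Rightarrow> 'o \<Rightarrow>
    (('o, 'm) icat, ('o, 'm) icat \<times> 'm \<times> ('o, 'm) icat) cat" where
  "cat_fiber C X = \<lparr>
     Obj = {A. internal_category C A \<and> iobj A = X},
     Arr = {(A, f, B). internal_category C A \<and> iobj A = X \<and> internal_category C B \<and> iobj B = X \<and>
              internal_functor C A B (Ide C X) f},
     Dom = (\<lambda>(A, f, B). A),
     Cod = (\<lambda>(A, f, B). B),
     Ide = (\<lambda>A. (A, Ide C (imor A), A)),
     Comp = (\<lambda>(B', g, D) (A, f, B). (A, g \<cdot>\<^bsub>C\<^esub> f, D))\<rparr>"

end

theory Submission
  imports Defs
begin

text \<open>Let \<open>u : A \<rightarrow> B\<close> be monic in the fiber and \<open>S\<close> an equivalence relation on \<open>A\<close>. The forgetful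
  functor to \<open>C\<close> that sends a category over \<open>X\<close> to its object of arrows sends these to a
  monomorphism and an equivalence relation in \<open>C\<close>. Let \<open>M\<close> be the largest saturating relation there
  and \<open>T\<close> the relation of those parallel arrows of \<open>B\<close> that are related by \<open>M\<close>. In a Gumm category
  every equivalence relation between parallel arrows is closed under composition: the shifting lemma,
  applied to the kernel pairs of the two projections of composable pairs, moves \<open>f T f'\<close> along the
  rectangle \<open>(f, 1), (f', 1), (f, g), (f', g)\<close>. Hence \<open>T\<close> lives in the fiber, and it is the largest
  saturating relation there because relations in the fiber only relate parallel arrows.\<close>

section \<open>Finite limits and internal composition\<close>

text \<open>Joint monicity, the laws of an equivalence relation and saturation are tested on
  generalized elements. In the fiber the stages of such elements are only the internal categories
  over \<open>X\<close>, in \<open>C\<close> they are all objects, so the descent from the fiber to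
  \<open>C\<close> is the delicate direction. Each property is reduced to one generic instance (a
  kernel, the two legs of a relation, a pullback of functors); this instance is given the structure
  of a category over \<open>X\<close>, the property is applied to it in the fiber, and every
  instance in \<open>C\<close> arises from it by precomposition. In the ascent, an arrow supplied by
  a universal property in \<open>C\<close> has to be a functor, which can be tested after
  composition with a jointly monic pair of functors. \<open>M\<close> itself is not usable in the
  fiber, since nothing forces it to relate only parallel arrows. Restricting it keeps saturation,
  which constrains the elements of the relation one at a time and so passes to smaller equivalence
  relations. The identities of the restriction come from reflexivity; the shifting lemma enters only
  for its composition.\<close>

context category
begin

lemma arr_hom: "f \<in> Arr C \<Longrightarrow> f \<in> hom C (Dom C f) (Cod C f)"
  by (simp add: hom_def)

lemma hom_obj: "f \<in> hom C A B \<Longrightarrow> A \<in> Obj C \<and> B \<in> Obj C"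
  using Dom_Obj Cod_Obj by (auto simp: hom_def)

lemma comp_arr [simp]:
  assumes "f \<in> Arr C" "g \<in> Arr C" "Cod C f = Dom C g"
  shows "g \<cdot> f \<in> Arr C" "Dom C (g \<cdot> f) = Dom C f" "Cod C (g \<cdot> f) = Cod C g"
  using Comp_hom[of f "Dom C f" "Cod C f" g "Cod C g"] assms by (auto simp: hom_def)

lemma comp_assoc [simp]:
  assumes "f \<in> Arr C" "g \<in> Arr C" "h \<in> Arr C" "Cod C f = Dom C g" "Cod C g = Dom C h"
  shows "(h \<cdot> g) \<cdot> f = h \<cdot> (g \<cdot> f)"
  using Comp_assoc[of f "Dom C f" "Cod C f" g "Cod C g" h "Cod C h"] assms by (auto simp: hom_def)

text \<open>Reassociation is conditional on typing, so equations between arrows are carried over to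
  generalized elements explicitly. With \<open>refl\<close> as first premise this is associativity
  alone; \<open>square_prefix\<close> rebrackets both sides.\<close>

lemma comp_prefix:
  assumes "g \<cdot> f = k" "f \<in> hom C A B" "g \<in> hom C B D" "h \<in> hom C Z A"
  shows "g \<cdot> (f \<cdot> h) = k \<cdot> h"
  using assms by (auto simp: hom_def)

lemma square_prefix:
  assumes "g \<cdot> f = g' \<cdot> f'" "f \<in> hom C A B" "g \<in> hom C B D" "f' \<in> hom C A B'" "g' \<in> hom C B' D"
    "h \<in> hom C Z A"
  shows "g \<cdot> (f \<cdot> h) = g' \<cdot> (f' \<cdot> h)"
  using comp_prefix[OF assms(1,2,3,6)] assms(4-6) by (simp add: hom_def)

lemma ide_arr [simp]:
  assumes "A \<in> Obj C"
  shows "Ide C A \<in> Arr C" "Dom C (Ide C A) = A" "Cod C (Ide C A) = A"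
  using Ide_hom[OF assms] by (auto simp: hom_def)

lemma comp_ide [simp]:
  assumes "f \<in> Arr C"
  shows "Dom C f = A \<Longrightarrow> f \<cdot> Ide C A = f" "Cod C f = B \<Longrightarrow> Ide C B \<cdot> f = f"
  using Comp_Ide[of f] Ide_Comp[of f] assms by (auto simp: hom_def)

end

context finitely_complete_category
begin

lemma pullback_exists:
  assumes "f \<in> hom C A B" "g \<in> hom C A' B"
  shows "\<exists>p q. is_pullback C p q f g"
proof -
  \<comment> \<open>The cospan as a graph: vertices 0 and 1 are the two domains, vertex 2 is the
    common codomain, and edge \<open>e\<close> runs from vertex \<open>e\<close> to vertex
    2.\<close>
  let ?D = "\<lambda>v::nat. if v = 0 then A else if v = 1 then A' else B"
  let ?F = "\<lambda>e::nat. if e = 0 then f else g"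
  have "is_diagram C {0,1,2} {0,1} (\<lambda>e. e) (\<lambda>_. 2) ?D ?F"
    using assms hom_obj[OF assms(1)] hom_obj[OF assms(2)] by (auto simp: is_diagram_def)
  from finite_limits[OF _ _ this]
  obtain L p where "is_limit C {0,1,2} {0,1} (\<lambda>e. e) (\<lambda>_. 2) ?D ?F L p" by blast
  hence cone: "is_cone C {0,1,2} {0,1} (\<lambda>e. e) (\<lambda>_. 2) ?D ?F L p"
    and univ: "\<And>L' p'. is_cone C {0,1,2} {0,1} (\<lambda>e. e) (\<lambda>_. 2) ?D ?F L' p' \<Longrightarrow>
        (\<exists>!h. h \<in> hom C L' L \<and> (\<forall>v\<in>{0,1,2}. p v \<cdot> h = p' v))"
    by (auto simp: is_limit_def)
  have p: "p 0 \<in> hom C L A" "p 1 \<in> hom C L A'" "f \<cdot> p 0 = g \<cdot> p 1" "f \<cdot> p 0 = p 2"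
    using cone by (auto simp: is_cone_def)
  have u: "\<exists>!w. w \<in> hom C Z L \<and> p 0 \<cdot> w = a \<and> p 1 \<cdot> w = b"
    if "Z \<in> Obj C" "a \<in> hom C Z A" "b \<in> hom C Z A'" "f \<cdot> a = g \<cdot> b" for Z a b
  proof -
    let ?p = "\<lambda>v::nat. if v = 0 then a else if v = 1 then b else f \<cdot> a"
    have "is_cone C {0,1,2} {0,1} (\<lambda>e. e) (\<lambda>_. 2) ?D ?F Z ?p"
      using that assms by (auto simp: is_cone_def hom_def)
    from univ[OF this] have
      "\<exists>!h. h \<in> hom C Z L \<and> (\<forall>v\<in>{0,1,2}. p v \<cdot> h = ?p v)" .
    \<comment> \<open>The leg at vertex 2 is determined by the leg at vertex 0, so it drops out of
      the universal property.\<close>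
    moreover have "(\<forall>v\<in>{0,1,2}. p v \<cdot> h = ?p v) \<longleftrightarrow> p 0 \<cdot> h = a \<and> p 1 \<cdot> h = b"
      if "h \<in> hom C Z L" for h
    proof -
      have "p 2 \<cdot> h = f \<cdot> (p 0 \<cdot> h)" using comp_prefix[OF p(4,1) assms(1) that] by simp
      then show ?thesis by auto
    qed
    ultimately show ?thesis by (smt (verit, ccfv_threshold))
  qed
  have "Dom C (p 0) = L" "Dom C f = A" "Dom C g = A'" "f \<in> Arr C" "g \<in> Arr C" "Cod C f = Cod C g"
    using p assms by (auto simp: hom_def)
  then have "is_pullback C (p 0) (p 1) f g"
    using p u unfolding is_pullback_def by blast
  then show ?thesis by blast
qed

text \<open>Two equations are imposed at once because arrows of a category are parallel when both
  their sources and their targets agree. An ordinary equalizer is the case of two equal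
  pairs.\<close>

lemma joint_equalizer_exists:
  assumes "f \<in> hom C A B" "g \<in> hom C A B" "f' \<in> hom C A B'" "g' \<in> hom C A B'"
  shows "\<exists>L e. e \<in> hom C L A \<and> f \<cdot> e = g \<cdot> e \<and> f' \<cdot> e = g' \<cdot> e \<and>
    (\<forall>Z. \<forall>a\<in>hom C Z A. f \<cdot> a = g \<cdot> a \<and> f' \<cdot> a = g' \<cdot> a \<longrightarrow>
       (\<exists>!w. w \<in> hom C Z L \<and> e \<cdot> w = a))"
proof -
  let ?D = "\<lambda>v::nat. if v = 0 then A else if v = 1 then B else B'"
  let ?F = "\<lambda>e::nat. if e = 0 then f else if e = 1 then g else if e = 2 then f' else g'"
  \<comment> \<open>Edges 0 and 1 are the first parallel pair, ending at vertex 1; edges 2 and 3 are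
    the second, ending at vertex 2.\<close>
  let ?t = "\<lambda>e::nat. if e < 2 then 1 else (2::nat)"
  have "is_diagram C {0,1,2} {0,1,2,3} (\<lambda>e. 0) ?t ?D ?F"
    using assms hom_obj[OF assms(1)] hom_obj[OF assms(3)] by (auto simp: is_diagram_def)
  from finite_limits[OF _ _ this]
  obtain L p where "is_limit C {0,1,2} {0,1,2,3} (\<lambda>e. 0) ?t ?D ?F L p" by blast
  hence cone: "is_cone C {0,1,2} {0,1,2,3} (\<lambda>e. 0) ?t ?D ?F L p"
    and univ: "\<And>L' p'. is_cone C {0,1,2} {0,1,2,3} (\<lambda>e. 0) ?t ?D ?F L' p' \<Longrightarrow>
        (\<exists>!h. h \<in> hom C L' L \<and> (\<forall>v\<in>{0,1,2}. p v \<cdot> h = p' v))"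
    by (auto simp: is_limit_def)
  have p: "p 0 \<in> hom C L A" "f \<cdot> p 0 = p 1" "g \<cdot> p 0 = p 1" "f' \<cdot> p 0 = p 2" "g' \<cdot> p 0 = p 2"
    using cone by (auto simp: is_cone_def)
  have "\<exists>!w. w \<in> hom C Z L \<and> p 0 \<cdot> w = a"
    if "a \<in> hom C Z A" "f \<cdot> a = g \<cdot> a" "f' \<cdot> a = g' \<cdot> a" for Z a
  proof -
    let ?p = "\<lambda>v::nat. if v = 0 then a else if v = 1 then f \<cdot> a else f' \<cdot> a"
    have "is_cone C {0,1,2} {0,1,2,3} (\<lambda>e. 0) ?t ?D ?F Z ?p"
      using that assms hom_obj[OF that(1)] by (auto simp: is_cone_def hom_def)
    from univ[OF this] have
      "\<exists>!h. h \<in> hom C Z L \<and> (\<forall>v\<in>{0,1,2}. p v \<cdot> h = ?p v)" .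
    moreover have "(\<forall>v\<in>{0,1,2}. p v \<cdot> h = ?p v) \<longleftrightarrow> p 0 \<cdot> h = a"
      if "h \<in> hom C Z L" for h
    proof -
      have "p 1 \<cdot> h = f \<cdot> (p 0 \<cdot> h)" using comp_prefix[OF p(2,1) assms(1) that] by simp
      moreover have "p 2 \<cdot> h = f' \<cdot> (p 0 \<cdot> h)"
        using comp_prefix[OF p(4,1) assms(3) that] by simp
      ultimately show ?thesis by auto
    qed
    ultimately show ?thesis by (smt (verit, ccfv_threshold))
  qed
  with p show ?thesis by metis
qed

text \<open>The unit and associativity laws are left out, so that \<open>icomp\<close> can already
  be computed in a structure whose laws are still to be proved, as in
  \<open>initial_lift\<close>.\<close>

definition composition_graph :: "('a, 'b) icat \<Rightarrow> bool" where
  "composition_graph A \<longleftrightarrow> src A \<in> hom C (imor A) (iobj A) \<and> tgt A \<in> hom C (imor A) (iobj A) \<and>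
     cmp A \<in> hom C (Dom C (pairs1 C A)) (imor A) \<and>
     src A \<cdot> cmp A = src A \<cdot> pairs1 C A \<and> tgt A \<cdot> cmp A = tgt A \<cdot> pairs2 C A"

lemma internal_category_composition_graph: "internal_category C A \<Longrightarrow> composition_graph A"
  by (auto simp: internal_category_def composition_graph_def)

section \<open>Composable pairs and the composite of generalized elements\<close>

lemma composable_pairs_pullback:
  assumes "src A \<in> hom C M Y" "tgt A \<in> hom C M Y"
  shows "is_pullback C (pairs1 C A) (pairs2 C A) (tgt A) (src A)"
proof -
  obtain p q where "is_pullback C p q (tgt A) (src A)"
    using pullback_exists[OF assms(2,1)] by blast
  hence "case (p, q) of (p, q) \<Rightarrow> is_pullback C p q (tgt A) (src A)" by simp
  from someI[of "\<lambda>(p, q). is_pullback C p q (tgt A) (src A)", OF this]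
  show ?thesis unfolding composable_pairs_def by (simp add: case_prod_beta)
qed

lemma pairs_hom:
  assumes "src A \<in> hom C M Y" "tgt A \<in> hom C M Y"
  shows "pairs1 C A \<in> hom C (Dom C (pairs1 C A)) M" "pairs2 C A \<in> hom C (Dom C (pairs1 C A)) M"
    "tgt A \<cdot> pairs1 C A = src A \<cdot> pairs2 C A"
  using composable_pairs_pullback[OF assms] assms by (auto simp: is_pullback_def hom_def)

lemma composable_pair_exists:
  assumes "composition_graph A" "f \<in> hom C Z (imor A)" "g \<in> hom C Z (imor A)"
    "tgt A \<cdot> f = src A \<cdot> g"
  shows "\<exists>!w. w \<in> hom C Z (Dom C (pairs1 C A)) \<and> pairs1 C A \<cdot> w = f \<and> pairs2 C A \<cdot> w = g"
proof -
  have "is_pullback C (pairs1 C A) (pairs2 C A) (tgt A) (src A)"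
    using assms(1) composable_pairs_pullback unfolding composition_graph_def by blast
  then show ?thesis
    using assms hom_obj[OF assms(2)] unfolding is_pullback_def composition_graph_def
    by (auto simp: hom_def)
qed

lemma icomp_eq:
  assumes "composition_graph A" "f \<in> hom C Z (imor A)" "g \<in> hom C Z (imor A)"
    "tgt A \<cdot> f = src A \<cdot> g"
    "w \<in> hom C Z (Dom C (pairs1 C A))" "pairs1 C A \<cdot> w = f" "pairs2 C A \<cdot> w = g"
  shows "icomp C A f g = cmp A \<cdot> w"
proof -
  have "Dom C f = Z" using assms by (simp add: hom_def)
  then have "(THE w. w \<in> hom C (Dom C f) (Dom C (pairs1 C A)) \<and>
      pairs1 C A \<cdot> w = f \<and> pairs2 C A \<cdot> w = g) = w"
    using composable_pair_exists[OF assms(1-4)] assms(5-7) by (intro the1_equality) auto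
  then show ?thesis by (simp add: icomp_def)
qed

text \<open>Everything is read off from the arrow \<open>w\<close> that classifies the pair. The
  last conclusion, naturality in the stage, holds because \<open>w \<cdot> z\<close> classifies the
  restricted pair.\<close>

lemma icomp_hom:
  assumes "composition_graph A" "f \<in> hom C Z (imor A)" "g \<in> hom C Z (imor A)"
    "tgt A \<cdot> f = src A \<cdot> g"
  shows "icomp C A f g \<in> hom C Z (imor A)"
    and "src A \<cdot> icomp C A f g = src A \<cdot> f"
    and "tgt A \<cdot> icomp C A f g = tgt A \<cdot> g"
    and "z \<in> hom C Y Z \<Longrightarrow> icomp C A f g \<cdot> z = icomp C A (f \<cdot> z) (g \<cdot> z)"
proof -
  obtain w where w: "w \<in> hom C Z (Dom C (pairs1 C A))" "pairs1 C A \<cdot> w = f" "pairs2 C A \<cdot> w = g"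
    using composable_pair_exists[OF assms] by blast
  have A: "src A \<in> hom C (imor A) (iobj A)" "tgt A \<in> hom C (imor A) (iobj A)"
    "cmp A \<in> hom C (Dom C (pairs1 C A)) (imor A)"
    "src A \<cdot> cmp A = src A \<cdot> pairs1 C A" "tgt A \<cdot> cmp A = tgt A \<cdot> pairs2 C A"
    using assms(1) by (auto simp: composition_graph_def)
  note P = pairs_hom[OF A(1,2)]
  have e: "icomp C A f g = cmp A \<cdot> w" by (rule icomp_eq[OF assms w])
  show "icomp C A f g \<in> hom C Z (imor A)" using e A w by (auto simp: hom_def)
  show "src A \<cdot> icomp C A f g = src A \<cdot> f"
    using square_prefix[OF A(4,3,1) P(1) A(1) w(1)] e w by simp
  show "tgt A \<cdot> icomp C A f g = tgt A \<cdot> g"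
    using square_prefix[OF A(5,3,2) P(2) A(2) w(1)] e w by simp
  show "icomp C A f g \<cdot> z = icomp C A (f \<cdot> z) (g \<cdot> z)" if z: "z \<in> hom C Y Z"
  proof -
    have wz: "w \<cdot> z \<in> hom C Y (Dom C (pairs1 C A))" using w z by (auto simp: hom_def)
    note 1 = comp_prefix[OF w(2,1) P(1) z] and 2 = comp_prefix[OF w(3,1) P(2) z]
    note 3 = square_prefix[OF assms(4,2) A(2) assms(3) A(1) z]
    have "icomp C A (f \<cdot> z) (g \<cdot> z) = cmp A \<cdot> (w \<cdot> z)"
      by (rule icomp_eq[OF assms(1) _ _ 3 wz 1 2]) (use assms z in \<open>auto simp: hom_def\<close>)
    then show ?thesis using e w z A by (simp add: hom_def)
  qed
qed

end


section \<open>The fiber of internal categories over an object\<close>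

lemma fiber_simps:
  "A \<in> Obj (cat_fiber C X) \<longleftrightarrow> internal_category C A \<and> iobj A = X"
  "Dom (cat_fiber C X) (A, f, B) = A"
  "Cod (cat_fiber C X) (A, f, B) = B"
  "Ide (cat_fiber C X) A = (A, Ide C (imor A), A)"
  "Comp (cat_fiber C X) (B', g, D) (A, f, B) = (A, g \<cdot>\<^bsub>C\<^esub> f, D)"
  by (simp_all add: cat_fiber_def)

lemma fiber_hom_iff:
  "h \<in> hom (cat_fiber C X) A B \<longleftrightarrow> (\<exists>f. h = (A, f, B) \<and> (A, f, B) \<in> Arr (cat_fiber C X))"
  by (cases h) (auto simp: hom_def fiber_simps)

lemma triple_fiber_hom_iff:
  "(A', f, B') \<in> hom (cat_fiber C X) A B \<longleftrightarrow>
    A' = A \<and> B' = B \<and> (A, f, B) \<in> Arr (cat_fiber C X)"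
  by (auto simp: hom_def fiber_simps)

context finitely_complete_category
begin

lemma fiber_objD:
  assumes "A \<in> Obj (cat_fiber C X)"
  shows "internal_category C A" "composition_graph A" "X \<in> Obj C" "imor A \<in> Obj C" "iobj A = X"
    "src A \<in> hom C (imor A) X" "tgt A \<in> hom C (imor A) X" "idn A \<in> hom C X (imor A)"
    "cmp A \<in> hom C (Dom C (pairs1 C A)) (imor A)"
    "src A \<cdot> idn A = Ide C X" "tgt A \<cdot> idn A = Ide C X"
    "f \<in> hom C Z (imor A) \<Longrightarrow> icomp C A (idn A \<cdot> (src A \<cdot> f)) f = f"
    "f \<in> hom C Z (imor A) \<Longrightarrow> icomp C A f (idn A \<cdot> (tgt A \<cdot> f)) = f"
    "\<lbrakk>f \<in> hom C Z (imor A); g \<in> hom C Z (imor A); h \<in> hom C Z (imor A);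
      tgt A \<cdot> f = src A \<cdot> g; tgt A \<cdot> g = src A \<cdot> h\<rbrakk> \<Longrightarrow>
      icomp C A (icomp C A f g) h = icomp C A f (icomp C A g h)"
proof -
  have A: "internal_category C A" "iobj A = X" using assms by (auto simp: fiber_simps)
  show "internal_category C A" "composition_graph A" "X \<in> Obj C" "imor A \<in> Obj C" "iobj A = X"
    "src A \<in> hom C (imor A) X" "tgt A \<in> hom C (imor A) X" "idn A \<in> hom C X (imor A)"
    "cmp A \<in> hom C (Dom C (pairs1 C A)) (imor A)"
    "src A \<cdot> idn A = Ide C X" "tgt A \<cdot> idn A = Ide C X"
    using A internal_category_composition_graph[OF A(1)] by (auto simp: internal_category_def)
  show "f \<in> hom C Z (imor A) \<Longrightarrow> icomp C A (idn A \<cdot> (src A \<cdot> f)) f = f"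
    "f \<in> hom C Z (imor A) \<Longrightarrow> icomp C A f (idn A \<cdot> (tgt A \<cdot> f)) = f"
    using A hom_obj[of f Z "imor A"] unfolding internal_category_def by blast+
  show "\<lbrakk>f \<in> hom C Z (imor A); g \<in> hom C Z (imor A); h \<in> hom C Z (imor A);
      tgt A \<cdot> f = src A \<cdot> g; tgt A \<cdot> g = src A \<cdot> h\<rbrakk> \<Longrightarrow>
      icomp C A (icomp C A f g) h = icomp C A f (icomp C A g h)"
    using A hom_obj[of f Z "imor A"] unfolding internal_category_def by blast
qed

text \<open>A Yoneda argument: \<open>internal_functor\<close> states preservation of composites
  once, at the generic composable pair. An arbitrary pair is a restriction of it along its
  classifying arrow; conversely the two projections are themselves a composable pair.\<close>

lemma fiber_arr_iff:
  "(A, f, B) \<in> Arr (cat_fiber C X) \<longleftrightarrow>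
    A \<in> Obj (cat_fiber C X) \<and> B \<in> Obj (cat_fiber C X) \<and> f \<in> hom C (imor A) (imor B) \<and>
    src B \<cdot> f = src A \<and> tgt B \<cdot> f = tgt A \<and> f \<cdot> idn A = idn B \<and>
    (\<forall>Z. \<forall>a\<in>hom C Z (imor A). \<forall>b\<in>hom C Z (imor A). tgt A \<cdot> a = src A \<cdot> b \<longrightarrow>
       f \<cdot> icomp C A a b = icomp C B (f \<cdot> a) (f \<cdot> b))"
  (is "?l \<longleftrightarrow> ?r")
proof -
  let ?base = "A \<in> Obj (cat_fiber C X) \<and> B \<in> Obj (cat_fiber C X) \<and>
    f \<in> hom C (imor A) (imor B) \<and>
    src B \<cdot> f = src A \<and> tgt B \<cdot> f = tgt A \<and> f \<cdot> idn A = idn B"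
  let ?c = "f \<cdot> cmp A = icomp C B (f \<cdot> pairs1 C A) (f \<cdot> pairs2 C A)"
  let ?e = "\<forall>Z. \<forall>a\<in>hom C Z (imor A). \<forall>b\<in>hom C Z (imor A). tgt A \<cdot> a = src A \<cdot> b \<longrightarrow>
       f \<cdot> icomp C A a b = icomp C B (f \<cdot> a) (f \<cdot> b)"
  have *: "Ide C X \<cdot> src A = src A" "Ide C X \<cdot> tgt A = tgt A"
    if "A \<in> Obj (cat_fiber C X)" for A
    using fiber_objD[OF that] by (auto simp: hom_def)
  have **: "idn A \<cdot> Ide C X = idn A" if "A \<in> Obj (cat_fiber C X)" for A
    using fiber_objD[OF that] by (auto simp: hom_def)
  have "?l \<longleftrightarrow> A \<in> Obj (cat_fiber C X) \<and> B \<in> Obj (cat_fiber C X) \<and>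
      internal_functor C A B (Ide C X) f"
    by (auto simp: cat_fiber_def)
  also have "\<dots> \<longleftrightarrow> ?base \<and> ?c"
    using * ** fiber_objD(3,5) Ide_hom[of X] unfolding internal_functor_def by auto
  finally have l: "?l \<longleftrightarrow> ?base \<and> ?c" .
  have "?c \<longleftrightarrow> ?e" if base: ?base
  proof -
    note A = fiber_objD[of A, OF conjunct1[OF base]]
    have B: "B \<in> Obj (cat_fiber C X)" using base by blast
    note B = fiber_objD[OF B]
    note P = pairs_hom[OF A(6,7)]
    have fh: "f \<in> hom C (imor A) (imor B)" and fs: "src B \<cdot> f = src A" and ft: "tgt B \<cdot> f = tgt A"
      using base by auto
    have comp: "tgt B \<cdot> (f \<cdot> a) = src B \<cdot> (f \<cdot> b)"
      if "a \<in> hom C Z (imor A)" "b \<in> hom C Z (imor A)" "tgt A \<cdot> a = src A \<cdot> b" for Z a b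
      using comp_prefix[OF fs fh B(6) that(2)] comp_prefix[OF ft fh B(7) that(1)] that(3) by simp
    have fP: "f \<cdot> pairs1 C A \<in> hom C (Dom C (pairs1 C A)) (imor B)"
      "f \<cdot> pairs2 C A \<in> hom C (Dom C (pairs1 C A)) (imor B)"
      using P fh by (auto simp: hom_def)
    show ?thesis
    proof
      assume c: ?c
      show ?e
      proof (intro allI ballI impI)
        fix Z a b assume ab: "a \<in> hom C Z (imor A)" "b \<in> hom C Z (imor A)" "tgt A \<cdot> a = src A \<cdot> b"
        obtain w where w: "w \<in> hom C Z (Dom C (pairs1 C A))" "pairs1 C A \<cdot> w = a"
          "pairs2 C A \<cdot> w = b"
          using composable_pair_exists[OF A(2) ab] by blast
        have "f \<cdot> icomp C A a b = f \<cdot> (cmp A \<cdot> w)" using icomp_eq[OF A(2) ab w] by simp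
        also have "\<dots> = icomp C B (f \<cdot> pairs1 C A) (f \<cdot> pairs2 C A) \<cdot> w"
          by (rule comp_prefix[OF c A(9) fh w(1)])
        also have "\<dots> = icomp C B ((f \<cdot> pairs1 C A) \<cdot> w) ((f \<cdot> pairs2 C A) \<cdot> w)"
          by (rule icomp_hom(4)[OF B(2) fP comp[OF P] w(1)])
        also have "\<dots> = icomp C B (f \<cdot> a) (f \<cdot> b)"
          using comp_prefix[OF refl P(1) fh w(1)] comp_prefix[OF refl P(2) fh w(1)] w by simp
        finally show "f \<cdot> icomp C A a b = icomp C B (f \<cdot> a) (f \<cdot> b)" .
      qed
    next
      assume e: ?e
      have Z: "Dom C (pairs1 C A) \<in> Obj C" using P hom_obj by blast
      \<comment> \<open>The generic pair is classified by the identity, so its composite is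
        \<open>cmp A\<close> itself.\<close>
      have "icomp C A (pairs1 C A) (pairs2 C A) = cmp A \<cdot> Ide C (Dom C (pairs1 C A))"
        using P Z by (intro icomp_eq[OF A(2) P]) (auto simp: hom_def)
      also have "\<dots> = cmp A" using A(9) by (simp add: hom_def)
      finally show ?c using e P by metis
    qed
  qed
  then show ?thesis unfolding l by blast
qed

lemma fiber_arrD:
  assumes "(A, f, B) \<in> Arr (cat_fiber C X)"
  shows "A \<in> Obj (cat_fiber C X)" "B \<in> Obj (cat_fiber C X)" "f \<in> hom C (imor A) (imor B)"
    "src B \<cdot> f = src A" "tgt B \<cdot> f = tgt A" "f \<cdot> idn A = idn B"
    "\<lbrakk>a \<in> hom C Z (imor A); b \<in> hom C Z (imor A); tgt A \<cdot> a = src A \<cdot> b\<rbrakk> \<Longrightarrow>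
      f \<cdot> icomp C A a b = icomp C B (f \<cdot> a) (f \<cdot> b)"
    "a \<in> hom C Z (imor A) \<Longrightarrow> src B \<cdot> (f \<cdot> a) = src A \<cdot> a"
    "a \<in> hom C Z (imor A) \<Longrightarrow> tgt B \<cdot> (f \<cdot> a) = tgt A \<cdot> a"
    "a \<in> hom C Z (imor A) \<Longrightarrow> f \<cdot> a \<in> hom C Z (imor B)"
proof -
  show *: "A \<in> Obj (cat_fiber C X)" "B \<in> Obj (cat_fiber C X)" "f \<in> hom C (imor A) (imor B)"
    "src B \<cdot> f = src A" "tgt B \<cdot> f = tgt A" "f \<cdot> idn A = idn B"
    "\<lbrakk>a \<in> hom C Z (imor A); b \<in> hom C Z (imor A); tgt A \<cdot> a = src A \<cdot> b\<rbrakk> \<Longrightarrow>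
      f \<cdot> icomp C A a b = icomp C B (f \<cdot> a) (f \<cdot> b)"
    using assms unfolding fiber_arr_iff by blast+
  show "a \<in> hom C Z (imor A) \<Longrightarrow> src B \<cdot> (f \<cdot> a) = src A \<cdot> a"
    using comp_prefix[OF *(4,3) fiber_objD(6)[OF *(2)]] by blast
  show "a \<in> hom C Z (imor A) \<Longrightarrow> tgt B \<cdot> (f \<cdot> a) = tgt A \<cdot> a"
    using comp_prefix[OF *(5,3) fiber_objD(7)[OF *(2)]] by blast
  show "a \<in> hom C Z (imor A) \<Longrightarrow> f \<cdot> a \<in> hom C Z (imor B)"
    using *(3) Comp_hom by blast
qed

lemma fiber_category: "category (cat_fiber C X)"
proof
  fix h assume h: "h \<in> Arr (cat_fiber C X)"
  show "Dom (cat_fiber C X) h \<in> Obj (cat_fiber C X)"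
    "Cod (cat_fiber C X) h \<in> Obj (cat_fiber C X)"
    using h by (cases h; auto simp: fiber_simps dest: fiber_arrD)+
next
  fix A assume A: "A \<in> Obj (cat_fiber C X)"
  note D = fiber_objD[OF A]
  have "(A, Ide C (imor A), A) \<in> Arr (cat_fiber C X)"
    unfolding fiber_arr_iff
  proof (intro conjI allI ballI impI)
    fix Z a b assume ab: "a \<in> hom C Z (imor A)" "b \<in> hom C Z (imor A)" "tgt A \<cdot> a = src A \<cdot> b"
    show "Ide C (imor A) \<cdot> icomp C A a b = icomp C A (Ide C (imor A) \<cdot> a) (Ide C (imor A) \<cdot> b)"
      using Ide_Comp[OF icomp_hom(1)[OF D(2) ab]] ab(1,2)[THEN Ide_Comp] by simp
  qed (use A D Ide_hom Ide_Comp Comp_Ide in auto)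
  then show "Ide (cat_fiber C X) A \<in> hom (cat_fiber C X) A A"
    by (simp add: fiber_simps triple_fiber_hom_iff)
next
  fix f' A B g' D assume "f' \<in> hom (cat_fiber C X) A B" "g' \<in> hom (cat_fiber C X) B D"
  then obtain f g where f: "f' = (A, f, B)" "(A, f, B) \<in> Arr (cat_fiber C X)"
    and g: "g' = (B, g, D)" "(B, g, D) \<in> Arr (cat_fiber C X)" by (auto simp: fiber_hom_iff)
  note F = fiber_arrD[OF f(2)] note G = fiber_arrD[OF g(2)]
  have "(A, g \<cdot> f, D) \<in> Arr (cat_fiber C X)"
    unfolding fiber_arr_iff
  proof (intro conjI allI ballI impI)
    show "A \<in> Obj (cat_fiber C X)" "D \<in> Obj (cat_fiber C X)" by fact+
    show "g \<cdot> f \<in> hom C (imor A) (imor D)" using F G by (intro G(10))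
    show "src D \<cdot> (g \<cdot> f) = src A" "tgt D \<cdot> (g \<cdot> f) = tgt A"
      using G(8)[OF F(3)] G(9)[OF F(3)] F by auto
    show "(g \<cdot> f) \<cdot> idn A = idn D"
      using comp_prefix[OF refl F(3) G(3) fiber_objD(8)[OF F(1)]] F(6) G(6) by simp
    fix Z a b assume ab: "a \<in> hom C Z (imor A)" "b \<in> hom C Z (imor A)" "tgt A \<cdot> a = src A \<cdot> b"
    have gf: "(g \<cdot> f) \<cdot> x = g \<cdot> (f \<cdot> x)" if "x \<in> hom C Z (imor A)" for x
      using comp_prefix[OF refl F(3) G(3) that] by simp
    have "tgt B \<cdot> (f \<cdot> a) = src B \<cdot> (f \<cdot> b)" using F(8)[OF ab(2)] F(9)[OF ab(1)] ab by simp
    then show "(g \<cdot> f) \<cdot> icomp C A a b = icomp C D ((g \<cdot> f) \<cdot> a) ((g \<cdot> f) \<cdot> b)"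
      using gf[OF icomp_hom(1)[OF fiber_objD(2)[OF F(1)] ab]] gf[OF ab(1)] gf[OF ab(2)]
        F(7)[OF ab] G(7)[OF F(10)[OF ab(1)] F(10)[OF ab(2)]] by simp
  qed
  then show "Comp (cat_fiber C X) g' f' \<in> hom (cat_fiber C X) A D"
    by (simp add: f g fiber_simps triple_fiber_hom_iff)
next
  fix f' A B assume "f' \<in> hom (cat_fiber C X) A B"
  then obtain f where f: "f' = (A, f, B)" "(A, f, B) \<in> Arr (cat_fiber C X)"
    by (auto simp: fiber_hom_iff)
  show "Comp (cat_fiber C X) f' (Ide (cat_fiber C X) A) = f'"
    "Comp (cat_fiber C X) (Ide (cat_fiber C X) B) f' = f'"
    using fiber_arrD(3)[OF f(2)] Ide_Comp Comp_Ide by (auto simp: fiber_simps f)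
next
  fix f' A B g' D h' K assume "f' \<in> hom (cat_fiber C X) A B" "g' \<in> hom (cat_fiber C X) B D"
    "h' \<in> hom (cat_fiber C X) D K"
  then obtain f g h where f: "f' = (A, f, B)" "(A, f, B) \<in> Arr (cat_fiber C X)"
    and g: "g' = (B, g, D)" "(B, g, D) \<in> Arr (cat_fiber C X)"
    and h: "h' = (D, h, K)" "(D, h, K) \<in> Arr (cat_fiber C X)" by (auto simp: fiber_hom_iff)
  then show "Comp (cat_fiber C X) h' (Comp (cat_fiber C X) g' f') =
      Comp (cat_fiber C X) (Comp (cat_fiber C X) h' g') f'"
    using Comp_assoc[OF fiber_arrD(3)[OF f(2)] fiber_arrD(3)[OF g(2)] fiber_arrD(3)[OF h(2)]]
    by (simp add: fiber_simps)
qed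

text \<open>All laws of a category hold in each \<open>A j\<close>, and the joint monicity of
  \<open>s\<close>, \<open>t\<close> and the \<open>p j\<close> reflects them to \<open>M\<close>.
  Counting \<open>s\<close> and \<open>t\<close> among the jointly monic arrows makes the lemma
  meaningful for empty \<open>J\<close>, which is needed for the terminal object of the
  fiber.\<close>

lemma initial_lift:
  assumes X: "X \<in> Obj C" and s: "s \<in> hom C M X" and t: "t \<in> hom C M X"
    and A: "\<And>j. j \<in> J \<Longrightarrow> A j \<in> Obj (cat_fiber C X)"
    and p: "\<And>j. j \<in> J \<Longrightarrow> p j \<in> hom C M (imor (A j))"
    and ps: "\<And>j. j \<in> J \<Longrightarrow> src (A j) \<cdot> p j = s" and pt: "\<And>j. j \<in> J \<Longrightarrow> tgt (A j) \<cdot> p j = t"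
    and joint: "\<And>Z g h. \<lbrakk>g \<in> hom C Z M; h \<in> hom C Z M; s \<cdot> g = s \<cdot> h; t \<cdot> g = t \<cdot> h;
      \<And>j. j \<in> J \<Longrightarrow> p j \<cdot> g = p j \<cdot> h\<rbrakk> \<Longrightarrow> g = h"
    and i: "i \<in> hom C X M" "s \<cdot> i = Ide C X" "t \<cdot> i = Ide C X"
    and pi: "\<And>j. j \<in> J \<Longrightarrow> p j \<cdot> i = idn (A j)"
    and closed: "\<And>Z a b. \<lbrakk>a \<in> hom C Z M; b \<in> hom C Z M; t \<cdot> a = s \<cdot> b\<rbrakk> \<Longrightarrow>
      \<exists>c\<in>hom C Z M. s \<cdot> c = s \<cdot> a \<and> t \<cdot> c = t \<cdot> b \<and>
        (\<forall>j\<in>J. p j \<cdot> c = icomp C (A j) (p j \<cdot> a) (p j \<cdot> b))"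
  shows "\<exists>L. L \<in> Obj (cat_fiber C X) \<and> imor L = M \<and> src L = s \<and> tgt L = t \<and>
    (\<forall>j\<in>J. (L, p j, A j) \<in> Arr (cat_fiber C X))"
proof -
  define G where "G c = \<lparr>iobj = X, imor = M, src = s, tgt = t, idn = i, cmp = c\<rparr>" for c
  have G_simps [simp]: "iobj (G c) = X" "imor (G c) = M" "src (G c) = s" "tgt (G c) = t"
    "idn (G c) = i" "cmp (G c) = c" for c by (simp_all add: G_def)
  \<comment> \<open>\<open>composable_pairs\<close> looks only at \<open>src\<close> and
    \<open>tgt\<close>. The projections are therefore available before the composition, whose domain
    depends on them, has been chosen.\<close>
  obtain p1 p2 where pp: "\<And>c. composable_pairs C (G c) = (p1, p2)"
    by (cases "composable_pairs C (G undefined)") (simp add: composable_pairs_def)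
  define P where "P = Dom C p1"
  have P: "p1 \<in> hom C P M" "p2 \<in> hom C P M" "t \<cdot> p1 = s \<cdot> p2"
    using pairs_hom[of "G undefined" M X] s t by (auto simp: pp P_def)
  \<comment> \<open>The composition is the closure property evaluated at the generic composable
    pair.\<close>
  obtain c where c: "c \<in> hom C P M" "s \<cdot> c = s \<cdot> p1" "t \<cdot> c = t \<cdot> p2"
    "\<And>j. j \<in> J \<Longrightarrow> p j \<cdot> c = icomp C (A j) (p j \<cdot> p1) (p j \<cdot> p2)"
    using closed[OF P] by blast
  define L where "L = G c"
  have cg: "composition_graph L"
    using s t c P by (simp add: composition_graph_def L_def pp P_def)
  have composable: "tgt (A j) \<cdot> (p j \<cdot> a) = src (A j) \<cdot> (p j \<cdot> b)"
    if "j \<in> J" "a \<in> hom C Z M" "b \<in> hom C Z M" "t \<cdot> a = s \<cdot> b" for j Z a b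
  proof -
    note D = fiber_objD[OF A[OF that(1)]]
    show ?thesis
      using comp_prefix[OF pt[OF that(1)] p[OF that(1)] D(7) that(2)]
        comp_prefix[OF ps[OF that(1)] p[OF that(1)] D(6) that(3)] that(4) by simp
  qed
  have comp: "icomp C L a b \<in> hom C Z M" "s \<cdot> icomp C L a b = s \<cdot> a" "t \<cdot> icomp C L a b = t \<cdot> b"
    if "a \<in> hom C Z M" "b \<in> hom C Z M" "t \<cdot> a = s \<cdot> b" for Z a b
    using icomp_hom[OF cg, of a Z b] that by (auto simp: L_def)
  have pcomp: "p j \<cdot> icomp C L a b = icomp C (A j) (p j \<cdot> a) (p j \<cdot> b)"
    if j: "j \<in> J" and ab: "a \<in> hom C Z M" "b \<in> hom C Z M" "t \<cdot> a = s \<cdot> b" for j Z a b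
  proof -
    note D = fiber_objD[OF A[OF j]]
    obtain w where w: "w \<in> hom C Z P" "p1 \<cdot> w = a" "p2 \<cdot> w = b"
      using composable_pair_exists[OF cg, of a Z b] ab by (auto simp: L_def pp P_def)
    have "icomp C L a b = c \<cdot> w"
      using icomp_eq[OF cg, of a Z b w] ab w by (simp add: L_def pp P_def)
    then have "p j \<cdot> icomp C L a b = p j \<cdot> (c \<cdot> w)" by simp
    also have "\<dots> = icomp C (A j) (p j \<cdot> p1) (p j \<cdot> p2) \<cdot> w"
      by (rule comp_prefix[OF c(4)[OF j] c(1) p[OF j] w(1)])
    also have "\<dots> = icomp C (A j) ((p j \<cdot> p1) \<cdot> w) ((p j \<cdot> p2) \<cdot> w)"
      by (rule icomp_hom(4)[OF D(2) Comp_hom[OF P(1) p[OF j]] Comp_hom[OF P(2) p[OF j]]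
            composable[OF j P] w(1)])
    also have "\<dots> = icomp C (A j) (p j \<cdot> a) (p j \<cdot> b)"
      using comp_prefix[OF refl P(1) p[OF j] w(1)] comp_prefix[OF refl P(2) p[OF j] w(1)] w by simp
    finally show ?thesis .
  qed
  have "internal_category C L"
    unfolding internal_category_def
  proof (intro conjI ballI impI)
    show "iobj L \<in> Obj C" "imor L \<in> Obj C" using X hom_obj[OF s] by (auto simp: L_def)
    show "src L \<in> hom C (imor L) (iobj L)" "tgt L \<in> hom C (imor L) (iobj L)"
      "idn L \<in> hom C (iobj L) (imor L)" "cmp L \<in> hom C (Dom C (pairs1 C L)) (imor L)"
      "src L \<cdot> idn L = Ide C (iobj L)" "tgt L \<cdot> idn L = Ide C (iobj L)"
      "src L \<cdot> cmp L = src L \<cdot> pairs1 C L" "tgt L \<cdot> cmp L = tgt L \<cdot> pairs2 C L"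
      using s t i c by (auto simp: L_def pp P_def)
  next
    fix Z f assume "f \<in> hom C Z (imor L)"
    then have f: "f \<in> hom C Z M" by (simp add: L_def)
    have sf: "s \<cdot> f \<in> hom C Z X" and tf: "t \<cdot> f \<in> hom C Z X" using f s t Comp_hom by blast+
    have isf: "i \<cdot> (s \<cdot> f) \<in> hom C Z M" and itf: "i \<cdot> (t \<cdot> f) \<in> hom C Z M"
      using sf tf i Comp_hom by blast+
    have st: "s \<cdot> (i \<cdot> (s \<cdot> f)) = s \<cdot> f" "t \<cdot> (i \<cdot> (s \<cdot> f)) = s \<cdot> f"
      "s \<cdot> (i \<cdot> (t \<cdot> f)) = t \<cdot> f" "t \<cdot> (i \<cdot> (t \<cdot> f)) = t \<cdot> f"
      using comp_prefix[OF i(2,1) s sf] comp_prefix[OF i(3,1) t sf]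
        comp_prefix[OF i(2,1) s tf] comp_prefix[OF i(3,1) t tf] Ide_Comp[OF sf] Ide_Comp[OF tf]
      by auto
    have pj: "p j \<cdot> (i \<cdot> (s \<cdot> f)) = idn (A j) \<cdot> (src (A j) \<cdot> (p j \<cdot> f))"
      "p j \<cdot> (i \<cdot> (t \<cdot> f)) = idn (A j) \<cdot> (tgt (A j) \<cdot> (p j \<cdot> f))" if j: "j \<in> J" for j
      using comp_prefix[OF pi[OF j] i(1) p[OF j] sf] comp_prefix[OF pi[OF j] i(1) p[OF j] tf]
        comp_prefix[OF ps[OF j] p[OF j] fiber_objD(6)[OF A[OF j]] f]
        comp_prefix[OF pt[OF j] p[OF j] fiber_objD(7)[OF A[OF j]] f] by auto
    have "icomp C L (i \<cdot> (s \<cdot> f)) f = f"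
    proof (rule joint)
      show "p j \<cdot> icomp C L (i \<cdot> (s \<cdot> f)) f = p j \<cdot> f" if j: "j \<in> J" for j
        using pcomp[OF j isf f st(2)] pj[OF j]
          fiber_objD(12)[OF A[OF j] Comp_hom[OF f p[OF j]]] by simp
    qed (use comp[OF isf f st(2)] f st in auto)
    then show "icomp C L (idn L \<cdot> (src L \<cdot> f)) f = f" by (simp add: L_def)
    have "icomp C L f (i \<cdot> (t \<cdot> f)) = f"
    proof (rule joint)
      show "p j \<cdot> icomp C L f (i \<cdot> (t \<cdot> f)) = p j \<cdot> f" if j: "j \<in> J" for j
        using pcomp[OF j f itf st(3)[symmetric]] pj[OF j]
          fiber_objD(13)[OF A[OF j] Comp_hom[OF f p[OF j]]] by simp
    qed (use comp[OF f itf st(3)[symmetric]] f st in auto)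
    then show "icomp C L f (idn L \<cdot> (tgt L \<cdot> f)) = f" by (simp add: L_def)
  next
    fix Z f g h assume "f \<in> hom C Z (imor L)" "g \<in> hom C Z (imor L)" "h \<in> hom C Z (imor L)"
      "tgt L \<cdot> f = src L \<cdot> g \<and> tgt L \<cdot> g = src L \<cdot> h"
    then have f: "f \<in> hom C Z M" and g: "g \<in> hom C Z M" and h: "h \<in> hom C Z M"
      and fg: "t \<cdot> f = s \<cdot> g" and gh: "t \<cdot> g = s \<cdot> h" by (auto simp: L_def)
    note FG = comp[OF f g fg] note GH = comp[OF g h gh]
    have 1: "t \<cdot> icomp C L f g = s \<cdot> h" and 2: "t \<cdot> f = s \<cdot> icomp C L g h"
      using FG GH fg gh by auto
    show "icomp C L (icomp C L f g) h = icomp C L f (icomp C L g h)"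
    proof (rule joint)
      show "p j \<cdot> icomp C L (icomp C L f g) h = p j \<cdot> icomp C L f (icomp C L g h)"
        if j: "j \<in> J" for j
        using pcomp[OF j FG(1) h 1] pcomp[OF j f GH(1) 2] pcomp[OF j f g fg] pcomp[OF j g h gh]
          fiber_objD(14)[OF A[OF j] Comp_hom[OF f p[OF j]] Comp_hom[OF g p[OF j]]
            Comp_hom[OF h p[OF j]] composable[OF j f g fg] composable[OF j g h gh]] by simp
    qed (use comp[OF FG(1) h 1] comp[OF f GH(1) 2] FG GH in auto)
  qed
  then have Lobj: "L \<in> Obj (cat_fiber C X)" by (simp add: fiber_simps L_def)
  have "(L, p j, A j) \<in> Arr (cat_fiber C X)" if "j \<in> J" for j
    unfolding fiber_arr_iff using Lobj A p ps pt pi pcomp that by (auto simp: L_def)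
  then show ?thesis using Lobj by (intro exI[of _ L]) (auto simp: L_def)
qed

text \<open>Both sides of each functor equation agree after \<open>src L\<close>,
  \<open>tgt L\<close> and every \<open>p j\<close>, the last because \<open>p j\<close> and
  \<open>p j \<cdot> k\<close> are functors. This turns arrows produced by universal properties in
  \<open>C\<close> into arrows of the fiber.\<close>

lemma functoriality_reflected:
  assumes W: "W \<in> Obj (cat_fiber C X)" and L: "L \<in> Obj (cat_fiber C X)"
    and p: "\<And>j. j \<in> J \<Longrightarrow> (L, p j, A j) \<in> Arr (cat_fiber C X)"
    and joint: "\<And>Z g h. \<lbrakk>g \<in> hom C Z (imor L); h \<in> hom C Z (imor L); src L \<cdot> g = src L \<cdot> h;
      tgt L \<cdot> g = tgt L \<cdot> h; \<And>j. j \<in> J \<Longrightarrow> p j \<cdot> g = p j \<cdot> h\<rbrakk> \<Longrightarrow> g = h"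
    and k: "k \<in> hom C (imor W) (imor L)" "src L \<cdot> k = src W" "tgt L \<cdot> k = tgt W"
    and pk: "\<And>j. j \<in> J \<Longrightarrow> (W, p j \<cdot> k, A j) \<in> Arr (cat_fiber C X)"
  shows "(W, k, L) \<in> Arr (cat_fiber C X)"
proof -
  note DW = fiber_objD[OF W] note DL = fiber_objD[OF L]
  have sk: "src L \<cdot> (k \<cdot> x) = src W \<cdot> x" and tk: "tgt L \<cdot> (k \<cdot> x) = tgt W \<cdot> x"
    and hk: "k \<cdot> x \<in> hom C Z (imor L)" if "x \<in> hom C Z (imor W)" for Z x
    using comp_prefix[OF k(2,1) DL(6) that] comp_prefix[OF k(3,1) DL(7) that] Comp_hom[OF that k(1)]
    by auto
  have pkx: "p j \<cdot> (k \<cdot> x) = (p j \<cdot> k) \<cdot> x" if "j \<in> J" "x \<in> hom C Z (imor W)" for j Z x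
    using comp_prefix[OF refl k(1) fiber_arrD(3)[OF p[OF that(1)]] that(2)] .
  have "k \<cdot> idn W = idn L"
  proof (rule joint)
    show "p j \<cdot> (k \<cdot> idn W) = p j \<cdot> idn L" if j: "j \<in> J" for j
      using pkx[OF j DW(8)] fiber_arrD(6)[OF pk[OF j]] fiber_arrD(6)[OF p[OF j]] by simp
  qed (use sk[OF DW(8)] tk[OF DW(8)] hk[OF DW(8)] DW DL in auto)
  moreover have "k \<cdot> icomp C W a b = icomp C L (k \<cdot> a) (k \<cdot> b)"
    if ab: "a \<in> hom C Z (imor W)" "b \<in> hom C Z (imor W)" "tgt W \<cdot> a = src W \<cdot> b" for Z a b
  proof (rule joint)
    note I = icomp_hom[OF DW(2) ab]
    have kab: "tgt L \<cdot> (k \<cdot> a) = src L \<cdot> (k \<cdot> b)" using sk[OF ab(2)] tk[OF ab(1)] ab by simp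
    note K = icomp_hom[OF DL(2) hk[OF ab(1)] hk[OF ab(2)] kab]
    show "k \<cdot> icomp C W a b \<in> hom C Z (imor L)" "icomp C L (k \<cdot> a) (k \<cdot> b) \<in> hom C Z (imor L)"
      using hk[OF I(1)] K by auto
    show "src L \<cdot> (k \<cdot> icomp C W a b) = src L \<cdot> icomp C L (k \<cdot> a) (k \<cdot> b)"
      "tgt L \<cdot> (k \<cdot> icomp C W a b) = tgt L \<cdot> icomp C L (k \<cdot> a) (k \<cdot> b)"
      using sk[OF I(1)] tk[OF I(1)] I K sk[OF ab(1)] tk[OF ab(2)] by auto
    show "p j \<cdot> (k \<cdot> icomp C W a b) = p j \<cdot> icomp C L (k \<cdot> a) (k \<cdot> b)" if j: "j \<in> J" for j
      using pkx[OF j I(1)] fiber_arrD(7)[OF pk[OF j] ab] pkx[OF j ab(1)] pkx[OF j ab(2)]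
        fiber_arrD(7)[OF p[OF j] hk[OF ab(1)] hk[OF ab(2)] kab] by simp
  qed
  ultimately show ?thesis unfolding fiber_arr_iff using W L k by blast
qed

end


section \<open>Jointly monic pairs and internal relations\<close>

text \<open>The case \<open>p = q\<close> is monicity, so monomorphisms and relations share the same
  lemmas. In a category the unrestricted \<open>Z\<close> changes nothing, as domains of arrows are
  objects.\<close>

definition jointly_monic :: "('o, 'm) cat \<Rightarrow> 'm \<Rightarrow> 'm \<Rightarrow> bool" where
  "jointly_monic C p q \<longleftrightarrow> (\<forall>Z. \<forall>g\<in>hom C Z (Dom C p). \<forall>h\<in>hom C Z (Dom C p).
     p \<cdot>\<^bsub>C\<^esub> g = p \<cdot>\<^bsub>C\<^esub> h \<and> q \<cdot>\<^bsub>C\<^esub> g = q \<cdot>\<^bsub>C\<^esub> h \<longrightarrow> g = h)"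

lemma jointly_monicD:
  "\<lbrakk>jointly_monic C p q; g \<in> hom C Z (Dom C p); h \<in> hom C Z (Dom C p);
    p \<cdot>\<^bsub>C\<^esub> g = p \<cdot>\<^bsub>C\<^esub> h; q \<cdot>\<^bsub>C\<^esub> g = q \<cdot>\<^bsub>C\<^esub> h\<rbrakk> \<Longrightarrow> g = h"
  unfolding jointly_monic_def by blast

context category
begin

lemma monic_iff: "monic C u \<longleftrightarrow> u \<in> Arr C \<and> jointly_monic C u u"
  unfolding monic_def jointly_monic_def using hom_obj by blast

lemma is_relation_iff:
  "is_relation C X R \<longleftrightarrow> fst R \<in> hom C (apex C R) X \<and> snd R \<in> hom C (apex C R) X \<and>
     jointly_monic C (fst R) (snd R)"
  unfolding is_relation_def jointly_monic_def using hom_obj by blast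

lemma relatedI:
  assumes "h \<in> hom C Z (apex C R)" "fst R \<in> hom C (apex C R) X" "fst R \<cdot> h = x" "snd R \<cdot> h = y"
  shows "related C R x y"
proof -
  have "Dom C x = Z" using assms by (auto simp: hom_def)
  then show ?thesis using assms unfolding related_def by blast
qed

lemma relatedE:
  assumes "related C R x y" "x \<in> hom C Z X"
  obtains h where "h \<in> hom C Z (apex C R)" "fst R \<cdot> h = x" "snd R \<cdot> h = y"
  using assms unfolding related_def by (auto simp: hom_def)

lemma related_comp:
  assumes "related C R x y" "x \<in> hom C Z X" "is_relation C X R" "z \<in> hom C Y Z"
  shows "related C R (x \<cdot> z) (y \<cdot> z)"
proof -
  obtain h where h: "h \<in> hom C Z (apex C R)" "fst R \<cdot> h = x" "snd R \<cdot> h = y"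
    using relatedE[OF assms(1,2)] .
  have R: "fst R \<in> hom C (apex C R) X" "snd R \<in> hom C (apex C R) X"
    using assms(3) by (auto simp: is_relation_iff)
  show ?thesis
    by (rule relatedI[OF Comp_hom[OF assms(4) h(1)] R(1)])
      (use comp_prefix[OF h(2,1) R(1) assms(4)] comp_prefix[OF h(3,1) R(2) assms(4)] in auto)
qed

lemma internal_equivalenceI:
  assumes "is_relation C X R"
    and "\<And>Z x. x \<in> hom C Z X \<Longrightarrow> related C R x x"
    and "\<And>Z x y. \<lbrakk>x \<in> hom C Z X; y \<in> hom C Z X; related C R x y\<rbrakk> \<Longrightarrow> related C R y x"
    and "\<And>Z x y z. \<lbrakk>x \<in> hom C Z X; y \<in> hom C Z X; z \<in> hom C Z X; related C R x y;
      related C R y z\<rbrakk> \<Longrightarrow> related C R x z"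
  shows "internal_equivalence C X R"
  unfolding internal_equivalence_def
proof (intro conjI ballI assms(1) equivI)
  fix Z
  let ?r = "{(x, y). x \<in> hom C Z X \<and> y \<in> hom C Z X \<and> related C R x y}"
  show "?r \<subseteq> hom C Z X \<times> hom C Z X" by auto
  show "refl_on (hom C Z X) ?r" using assms(2) by (auto simp: refl_on_def)
  show "sym ?r" using assms(3) by (auto simp: sym_def)
  show "trans ?r" using assms(4) unfolding trans_def by blast
qed

lemma internal_equivalenceD:
  assumes "internal_equivalence C X R"
  shows "is_relation C X R"
    and "x \<in> hom C Z X \<Longrightarrow> related C R x x"
    and "\<lbrakk>x \<in> hom C Z X; y \<in> hom C Z X; related C R x y\<rbrakk> \<Longrightarrow> related C R y x"
    and "\<lbrakk>x \<in> hom C Z X; y \<in> hom C Z X; z \<in> hom C Z X; related C R x y;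
      related C R y z\<rbrakk> \<Longrightarrow> related C R x z"
proof -
  let ?r = "\<lambda>Z. {(x, y). x \<in> hom C Z X \<and> y \<in> hom C Z X \<and> related C R x y}"
  show "is_relation C X R" using assms by (simp add: internal_equivalence_def)
  have e: "x \<in> hom C Z X \<Longrightarrow> equiv (hom C Z X) (?r Z)" for x Z
    using assms hom_obj by (auto simp: internal_equivalence_def)
  show "x \<in> hom C Z X \<Longrightarrow> related C R x x"
    using e[of x Z] by (auto simp: equiv_def refl_on_def)
  show "\<lbrakk>x \<in> hom C Z X; y \<in> hom C Z X; related C R x y\<rbrakk> \<Longrightarrow> related C R y x"
    using e[of x Z] unfolding equiv_def sym_def by blast
  show "\<lbrakk>x \<in> hom C Z X; y \<in> hom C Z X; z \<in> hom C Z X; related C R x y;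
      related C R y z\<rbrakk> \<Longrightarrow> related C R x z"
    using e[of x Z] unfolding equiv_def trans_def by blast
qed

text \<open>The universal property is split into existence and joint monicity, which are used
  separately later.\<close>

lemma pullbackD:
  assumes "is_pullback C p q f g"
  shows "p \<in> hom C (Dom C p) (Dom C f)" "q \<in> hom C (Dom C p) (Dom C g)" "f \<cdot> p = g \<cdot> q"
    "\<lbrakk>a \<in> hom C Z (Dom C f); b \<in> hom C Z (Dom C g); f \<cdot> a = g \<cdot> b\<rbrakk> \<Longrightarrow>
       \<exists>w\<in>hom C Z (Dom C p). p \<cdot> w = a \<and> q \<cdot> w = b"
    "jointly_monic C p q"
proof -
  have univ: "\<exists>!w. w \<in> hom C Z (Dom C p) \<and> p \<cdot> w = a \<and> q \<cdot> w = b"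
    if "a \<in> hom C Z (Dom C f)" "b \<in> hom C Z (Dom C g)" "f \<cdot> a = g \<cdot> b" for Z a b
    using assms that hom_obj[OF that(1)] unfolding is_pullback_def by blast
  show *: "p \<in> hom C (Dom C p) (Dom C f)" "q \<in> hom C (Dom C p) (Dom C g)" "f \<cdot> p = g \<cdot> q"
    using assms by (auto simp: is_pullback_def)
  show "\<lbrakk>a \<in> hom C Z (Dom C f); b \<in> hom C Z (Dom C g); f \<cdot> a = g \<cdot> b\<rbrakk> \<Longrightarrow>
       \<exists>w\<in>hom C Z (Dom C p). p \<cdot> w = a \<and> q \<cdot> w = b"
    using univ by blast
  have fg: "f \<in> hom C (Dom C f) (Cod C f)" "g \<in> hom C (Dom C g) (Cod C f)"
    using assms by (auto simp: is_pullback_def hom_def)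
  show "jointly_monic C p q"
    unfolding jointly_monic_def
  proof (intro allI ballI impI)
    fix Z h k assume h: "h \<in> hom C Z (Dom C p)" and k: "k \<in> hom C Z (Dom C p)"
      and hk: "p \<cdot> h = p \<cdot> k \<and> q \<cdot> h = q \<cdot> k"
    have "f \<cdot> (p \<cdot> h) = g \<cdot> (q \<cdot> h)"
      by (rule square_prefix[OF *(3,1) fg(1) *(2) fg(2) h])
    from univ[OF Comp_hom[OF h *(1)] Comp_hom[OF h *(2)] this] h k hk show "h = k" by metis
  qed
qed

end


section \<open>Limits and relations in the fiber\<close>

context finitely_complete_category
begin

text \<open>A limit in the fiber is a limit in \<open>C\<close> of the diagram of objects of arrows extended by their
  sources and targets, all landing in two copies of \<open>X\<close>. The two copies are the vertices \<open>0\<close>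
  and \<open>1\<close>; a vertex \<open>v\<close> is renumbered to \<open>v + 2\<close>, its source and target to the edges \<open>3 * v\<close> and
  \<open>3 * v + 1\<close>, and an edge \<open>e\<close> to \<open>3 * e + 2\<close>.\<close>

lemma fiber_finitely_complete:
  assumes X: "X \<in> Obj C"
  shows "finitely_complete_category (cat_fiber C X)"
proof (intro finitely_complete_category.intro fiber_category finitely_complete_category_axioms.intro)
  fix V E :: "nat set" and s t D F
  assume V: "finite V" and E: "finite E" and dia: "is_diagram (cat_fiber C X) V E s t D F"
  define f where "f e = fst (snd (F e))" for e
  have D: "D v \<in> Obj (cat_fiber C X)" if "v \<in> V" for v using dia that by (simp add: is_diagram_def)
  have st: "s e \<in> V" "t e \<in> V" if "e \<in> E" for e using dia that by (auto simp: is_diagram_def)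
  have F: "F e = (D (s e), f e, D (t e))" "(D (s e), f e, D (t e)) \<in> Arr (cat_fiber C X)"
    if "e \<in> E" for e
  proof -
    have "F e \<in> hom (cat_fiber C X) (D (s e)) (D (t e))" using dia that by (simp add: is_diagram_def)
    then show "F e = (D (s e), f e, D (t e))" "(D (s e), f e, D (t e)) \<in> Arr (cat_fiber C X)"
      by (auto simp: fiber_hom_iff f_def)
  qed
  define V' where "V' = {0, 1} \<union> (\<lambda>v. v + 2) ` V"
  define E' where "E' = (\<lambda>v. 3 * v) ` V \<union> (\<lambda>v. 3 * v + 1) ` V \<union> (\<lambda>e. 3 * e + 2) ` E"
  define s' where "s' e = (if e mod 3 = 2 then s (e div 3) + 2 else e div 3 + 2)" for e
  define t' where "t' e = (if e mod 3 = 0 then 0 else if e mod 3 = 1 then 1 else t (e div 3) + 2)"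
    for e :: nat
  define D' where "D' v = (if v < 2 then X else imor (D (v - 2)))" for v
  define F' where "F' e = (if e mod 3 = 0 then src (D (e div 3))
    else if e mod 3 = 1 then tgt (D (e div 3)) else f (e div 3))" for e
  have m: "(3 * v + 2) mod 3 = 2" "(3 * v + 2) div 3 = v"
    "(3 * v + 1) mod 3 = 1" "(3 * v + 1) div 3 = v" for v :: nat by arith+
  have s'_simps: "s' (3 * v) = v + 2" "s' (3 * v + 1) = v + 2" "s' (3 * v + 2) = s v + 2" for v
    by (simp_all add: s'_def m del: add_2_eq_Suc' One_nat_def)
  have t'_simps: "t' (3 * v) = 0" "t' (3 * v + 1) = 1" "t' (3 * v + 2) = t v + 2" for v
    by (simp_all add: t'_def m del: add_2_eq_Suc' One_nat_def)
  have F'_simps: "F' (3 * v) = src (D v)" "F' (3 * v + 1) = tgt (D v)" "F' (3 * v + 2) = f v" for v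
    by (simp_all add: F'_def m del: add_2_eq_Suc' One_nat_def)
  have D'_simps: "D' 0 = X" "D' 1 = X" "D' (v + 2) = imor (D v)" for v by (simp_all add: D'_def)
  have fin: "finite V'" "finite E'" using V E by (auto simp: V'_def E'_def)
  have all_V': "(\<forall>v\<in>V'. Q v) \<longleftrightarrow> Q 0 \<and> Q 1 \<and> (\<forall>v\<in>V. Q (v + 2))" for Q
    by (auto simp: V'_def)
  have all_E': "(\<forall>e\<in>E'. Q e) \<longleftrightarrow> (\<forall>v\<in>V. Q (3 * v)) \<and> (\<forall>v\<in>V. Q (3 * v + 1)) \<and>
      (\<forall>e\<in>E. Q (3 * e + 2))" for Q
    by (auto simp: E'_def)
  have mem_V': "0 \<in> V'" "1 \<in> V'" "v + 2 \<in> V' \<longleftrightarrow> v \<in> V" for v by (auto simp: V'_def)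
  have "is_diagram C V' E' s' t' D' F'"
    unfolding is_diagram_def all_V' all_E' s'_simps t'_simps F'_simps D'_simps mem_V'(3)
    using mem_V'(1,2) D[THEN fiber_objD(4)] D[THEN fiber_objD(6)] D[THEN fiber_objD(7)] X st
      F(2)[THEN fiber_arrD(3)] by blast
  from finite_limits[OF fin this]
  obtain M p where "is_limit C V' E' s' t' D' F' M p" by blast
  then have cone: "is_cone C V' E' s' t' D' F' M p"
    and univ': "\<And>Z q. is_cone C V' E' s' t' D' F' Z q \<Longrightarrow>
      \<exists>!h. h \<in> hom C Z M \<and> (\<forall>v\<in>V'. p v \<cdot> h = q v)"
    by (auto simp: is_limit_def)
  have cone_iff: "is_cone C V' E' s' t' D' F' Z q \<longleftrightarrow> Z \<in> Obj C \<and>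
      q 0 \<in> hom C Z X \<and> q 1 \<in> hom C Z X \<and> (\<forall>v\<in>V. q (v + 2) \<in> hom C Z (imor (D v))) \<and>
      (\<forall>v\<in>V. src (D v) \<cdot> q (v + 2) = q 0) \<and> (\<forall>v\<in>V. tgt (D v) \<cdot> q (v + 2) = q 1) \<and>
      (\<forall>e\<in>E. f e \<cdot> q (s e + 2) = q (t e + 2))" for Z q
    unfolding is_cone_def all_V' all_E' s'_simps t'_simps F'_simps D'_simps by blast
  define \<pi> where "\<pi> v = p (v + 2)" for v
  have p0: "p 0 \<in> hom C M X" and p1: "p 1 \<in> hom C M X"
    and \<pi>: "\<And>v. v \<in> V \<Longrightarrow> \<pi> v \<in> hom C M (imor (D v))"
    and \<pi>s: "\<And>v. v \<in> V \<Longrightarrow> src (D v) \<cdot> \<pi> v = p 0" and \<pi>t: "\<And>v. v \<in> V \<Longrightarrow> tgt (D v) \<cdot> \<pi> v = p 1"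
    and \<pi>f: "\<And>e. e \<in> E \<Longrightarrow> f e \<cdot> \<pi> (s e) = \<pi> (t e)"
    using cone unfolding cone_iff \<pi>_def by auto
  have univ: "\<exists>!h. h \<in> hom C Z M \<and> p 0 \<cdot> h = a \<and> p 1 \<cdot> h = b \<and> (\<forall>v\<in>V. \<pi> v \<cdot> h = q v)"
    if "a \<in> hom C Z X" "b \<in> hom C Z X" "\<And>v. v \<in> V \<Longrightarrow> q v \<in> hom C Z (imor (D v))"
      "\<And>v. v \<in> V \<Longrightarrow> src (D v) \<cdot> q v = a" "\<And>v. v \<in> V \<Longrightarrow> tgt (D v) \<cdot> q v = b"
      "\<And>e. e \<in> E \<Longrightarrow> f e \<cdot> q (s e) = q (t e)" for Z a b q
  proof -
    define q' where "q' v = (if v = 0 then a else if v = 1 then b else q (v - 2))" for v :: nat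
    have q': "q' 0 = a" "q' 1 = b" "q' (v + 2) = q v" for v by (simp_all add: q'_def)
    have "is_cone C V' E' s' t' D' F' Z q'"
      unfolding cone_iff q' using that hom_obj[OF that(1)] by blast
    from univ'[OF this] show ?thesis unfolding all_V' q' \<pi>_def .
  qed
  have joint: "g = h" if gh: "g \<in> hom C Z M" "h \<in> hom C Z M" "p 0 \<cdot> g = p 0 \<cdot> h" "p 1 \<cdot> g = p 1 \<cdot> h"
    "\<And>v. v \<in> V \<Longrightarrow> \<pi> v \<cdot> g = \<pi> v \<cdot> h" for Z g h
  proof -
    have "\<exists>!h. h \<in> hom C Z M \<and> p 0 \<cdot> h = p 0 \<cdot> g \<and> p 1 \<cdot> h = p 1 \<cdot> g \<and> (\<forall>v\<in>V. \<pi> v \<cdot> h = \<pi> v \<cdot> g)"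
    proof (rule univ)
      show "p 0 \<cdot> g \<in> hom C Z X" "p 1 \<cdot> g \<in> hom C Z X" using gh p0 p1 Comp_hom by blast+
      fix v assume v: "v \<in> V"
      show "\<pi> v \<cdot> g \<in> hom C Z (imor (D v))" using Comp_hom[OF gh(1) \<pi>[OF v]] .
      show "src (D v) \<cdot> (\<pi> v \<cdot> g) = p 0 \<cdot> g"
        by (rule comp_prefix[OF \<pi>s[OF v] \<pi>[OF v] fiber_objD(6)[OF D[OF v]] gh(1)])
      show "tgt (D v) \<cdot> (\<pi> v \<cdot> g) = p 1 \<cdot> g"
        by (rule comp_prefix[OF \<pi>t[OF v] \<pi>[OF v] fiber_objD(7)[OF D[OF v]] gh(1)])
    next
      fix e assume e: "e \<in> E"
      show "f e \<cdot> (\<pi> (s e) \<cdot> g) = \<pi> (t e) \<cdot> g"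
        by (rule comp_prefix[OF \<pi>f[OF e] \<pi>[OF st(1)[OF e]] fiber_arrD(3)[OF F(2)[OF e]] gh(1)])
    qed
    then show ?thesis using gh by (metis (no_types, lifting))
  qed
  \<comment> \<open>The identities of the \<open>D v\<close> form a cone on \<open>X\<close> because
    the functors of the diagram preserve them; the induced arrow will be the identity structure of
    the limit.\<close>
  have "\<exists>!h. h \<in> hom C X M \<and> p 0 \<cdot> h = Ide C X \<and> p 1 \<cdot> h = Ide C X \<and>
      (\<forall>v\<in>V. \<pi> v \<cdot> h = idn (D v))"
    by (rule univ) (use Ide_hom[OF X] fiber_objD(8,10,11)[OF D] fiber_arrD(6)[OF F(2)] in auto)
  then obtain i where i: "i \<in> hom C X M" "p 0 \<cdot> i = Ide C X" "p 1 \<cdot> i = Ide C X"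
    "\<And>v. v \<in> V \<Longrightarrow> \<pi> v \<cdot> i = idn (D v)" by blast
  have closed: "\<exists>c\<in>hom C Z M. p 0 \<cdot> c = p 0 \<cdot> a \<and> p 1 \<cdot> c = p 1 \<cdot> b \<and>
      (\<forall>v\<in>V. \<pi> v \<cdot> c = icomp C (D v) (\<pi> v \<cdot> a) (\<pi> v \<cdot> b))"
    if ab: "a \<in> hom C Z M" "b \<in> hom C Z M" "p 1 \<cdot> a = p 0 \<cdot> b" for Z a b
  proof -
    have h: "\<pi> v \<cdot> a \<in> hom C Z (imor (D v))" "\<pi> v \<cdot> b \<in> hom C Z (imor (D v))" if "v \<in> V" for v
      using Comp_hom[OF ab(1) \<pi>[OF that]] Comp_hom[OF ab(2) \<pi>[OF that]] by auto
    have sa: "src (D v) \<cdot> (\<pi> v \<cdot> a) = p 0 \<cdot> a" and ta: "tgt (D v) \<cdot> (\<pi> v \<cdot> a) = p 1 \<cdot> a"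
      and sb: "src (D v) \<cdot> (\<pi> v \<cdot> b) = p 0 \<cdot> b" and tb: "tgt (D v) \<cdot> (\<pi> v \<cdot> b) = p 1 \<cdot> b"
      if v: "v \<in> V" for v
      using comp_prefix[OF \<pi>s[OF v] \<pi>[OF v] fiber_objD(6)[OF D[OF v]]]
        comp_prefix[OF \<pi>t[OF v] \<pi>[OF v] fiber_objD(7)[OF D[OF v]]] ab by auto
    have tasb: "tgt (D v) \<cdot> (\<pi> v \<cdot> a) = src (D v) \<cdot> (\<pi> v \<cdot> b)" if "v \<in> V" for v
      using ta sb that ab by simp
    note I = icomp_hom[OF fiber_objD(2)[OF D] h(1) h(2) tasb]
    \<comment> \<open>Componentwise composites are again compatible with the edges, since each
      \<open>f e\<close> preserves composition.\<close>
    have "\<exists>!c. c \<in> hom C Z M \<and> p 0 \<cdot> c = p 0 \<cdot> a \<and> p 1 \<cdot> c = p 1 \<cdot> b \<and>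
      (\<forall>v\<in>V. \<pi> v \<cdot> c = icomp C (D v) (\<pi> v \<cdot> a) (\<pi> v \<cdot> b))"
    proof (rule univ)
      show "p 0 \<cdot> a \<in> hom C Z X" "p 1 \<cdot> b \<in> hom C Z X" using ab p0 p1 Comp_hom by blast+
    next
      fix e assume e: "e \<in> E"
      note v = st(1)[OF e] note g = fiber_arrD[OF F(2)[OF e]]
      show "f e \<cdot> icomp C (D (s e)) (\<pi> (s e) \<cdot> a) (\<pi> (s e) \<cdot> b) =
          icomp C (D (t e)) (\<pi> (t e) \<cdot> a) (\<pi> (t e) \<cdot> b)"
        using g(7)[OF h[OF v] tasb[OF v]] comp_prefix[OF \<pi>f[OF e] \<pi>[OF v] g(3) ab(1)]
          comp_prefix[OF \<pi>f[OF e] \<pi>[OF v] g(3) ab(2)] by simp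
    qed (use I sa tb in auto)
    then show ?thesis by blast
  qed
  have "\<exists>L. L \<in> Obj (cat_fiber C X) \<and> imor L = M \<and> src L = p 0 \<and> tgt L = p 1 \<and>
    (\<forall>v\<in>V. (L, \<pi> v, D v) \<in> Arr (cat_fiber C X))"
  proof (rule initial_lift[OF X p0 p1, where J = V and A = D and p = \<pi> and i = i])
    fix Z g h
    assume "g \<in> hom C Z M" "h \<in> hom C Z M" "p 0 \<cdot> g = p 0 \<cdot> h" "p 1 \<cdot> g = p 1 \<cdot> h"
      "\<And>v. v \<in> V \<Longrightarrow> \<pi> v \<cdot> g = \<pi> v \<cdot> h"
    then show "g = h" by (rule joint)
  qed (use D \<pi> \<pi>s \<pi>t i closed in blast)+
  then obtain L where L: "L \<in> Obj (cat_fiber C X)" "imor L = M" "src L = p 0" "tgt L = p 1"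
    "\<And>v. v \<in> V \<Longrightarrow> (L, \<pi> v, D v) \<in> Arr (cat_fiber C X)" by blast
  have "is_limit (cat_fiber C X) V E s t D F L (\<lambda>v. (L, \<pi> v, D v))"
    unfolding is_limit_def
  proof (intro conjI allI impI)
    show "is_cone (cat_fiber C X) V E s t D F L (\<lambda>v. (L, \<pi> v, D v))"
      unfolding is_cone_def using L F(1) \<pi>f by (simp add: triple_fiber_hom_iff fiber_simps)
    fix L' p' assume cone': "is_cone (cat_fiber C X) V E s t D F L' p'"
    define q where "q v = fst (snd (p' v))" for v
    have L': "L' \<in> Obj (cat_fiber C X)" using cone' by (simp add: is_cone_def)
    have p': "p' v = (L', q v, D v)" "(L', q v, D v) \<in> Arr (cat_fiber C X)" if "v \<in> V" for v
    proof -
      have "p' v \<in> hom (cat_fiber C X) L' (D v)" using cone' that by (simp add: is_cone_def)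
      then show "p' v = (L', q v, D v)" "(L', q v, D v) \<in> Arr (cat_fiber C X)"
        by (auto simp: fiber_hom_iff q_def)
    qed
    have qf: "f e \<cdot> q (s e) = q (t e)" if "e \<in> E" for e
    proof -
      have "Comp (cat_fiber C X) (F e) (p' (s e)) = p' (t e)"
        using cone' that by (simp add: is_cone_def)
      then show ?thesis using p'(1) st F(1) that by (simp add: fiber_simps)
    qed
    \<comment> \<open>The legs of a cone in the fiber commute with sources and targets, so
      \<open>src L'\<close> and \<open>tgt L'\<close> serve as the legs at the two copies of
      \<open>X\<close>.\<close>
    have ex1: "\<exists>!h. h \<in> hom C (imor L') M \<and> p 0 \<cdot> h = src L' \<and> p 1 \<cdot> h = tgt L' \<and>
        (\<forall>v\<in>V. \<pi> v \<cdot> h = q v)"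
      by (rule univ) (use fiber_objD[OF L'] fiber_arrD[OF p'(2)] qf in auto)
    then obtain h where h: "h \<in> hom C (imor L') M" "p 0 \<cdot> h = src L'" "p 1 \<cdot> h = tgt L'"
      "\<And>v. v \<in> V \<Longrightarrow> \<pi> v \<cdot> h = q v" by blast
    have hA: "(L', h, L) \<in> Arr (cat_fiber C X)"
      by (rule functoriality_reflected[OF L' L(1), where J = V and p = \<pi> and A = D])
        (use L h joint p' in auto)
    show "\<exists>!h. h \<in> hom (cat_fiber C X) L' L \<and>
        (\<forall>v\<in>V. Comp (cat_fiber C X) (L, \<pi> v, D v) h = p' v)"
    proof (intro ex1I conjI ballI)
      show "(L', h, L) \<in> hom (cat_fiber C X) L' L" using hA by (simp add: triple_fiber_hom_iff)
      show "Comp (cat_fiber C X) (L, \<pi> v, D v) (L', h, L) = p' v" if "v \<in> V" for v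
        using h p' that by (simp add: fiber_simps)
      fix h' assume h': "h' \<in> hom (cat_fiber C X) L' L \<and>
        (\<forall>v\<in>V. Comp (cat_fiber C X) (L, \<pi> v, D v) h' = p' v)"
      then obtain k where k: "h' = (L', k, L)" "(L', k, L) \<in> Arr (cat_fiber C X)"
        by (auto simp: fiber_hom_iff)
      have "\<pi> v \<cdot> k = q v" if "v \<in> V" for v
        using h' that p' by (auto simp: k fiber_simps)
      then have "k = h" using ex1 h fiber_arrD[OF k(2)] L by metis
      then show "h' = (L', h, L)" by (simp add: k)
    qed
  qed
  then show "\<exists>L p. is_limit (cat_fiber C X) V E s t D F L p" by blast
qed

text \<open>The family of two legs, indexed by the Booleans. Source and target of \<open>M\<close>
  are defined through \<open>p\<close>, so they add nothing to the joint monicity of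
  \<open>p\<close> and \<open>q\<close>.\<close>

lemma pair_lift:
  assumes A: "A \<in> Obj (cat_fiber C X)" and B: "B \<in> Obj (cat_fiber C X)"
    and p: "p \<in> hom C M (imor A)" and q: "q \<in> hom C M (imor B)"
    and s: "src A \<cdot> p = src B \<cdot> q" and t: "tgt A \<cdot> p = tgt B \<cdot> q"
    and joint: "jointly_monic C p q"
    and i: "i \<in> hom C X M" "p \<cdot> i = idn A" "q \<cdot> i = idn B"
    and closed: "\<And>Z a b. \<lbrakk>a \<in> hom C Z M; b \<in> hom C Z M; tgt A \<cdot> (p \<cdot> a) = src A \<cdot> (p \<cdot> b);
      tgt B \<cdot> (q \<cdot> a) = src B \<cdot> (q \<cdot> b)\<rbrakk> \<Longrightarrow>
      \<exists>c\<in>hom C Z M. p \<cdot> c = icomp C A (p \<cdot> a) (p \<cdot> b) \<and> q \<cdot> c = icomp C B (q \<cdot> a) (q \<cdot> b)"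
  shows "\<exists>L. L \<in> Obj (cat_fiber C X) \<and> imor L = M \<and> (L, p, A) \<in> Arr (cat_fiber C X) \<and>
    (L, q, B) \<in> Arr (cat_fiber C X)"
proof -
  note DA = fiber_objD[OF A] note DB = fiber_objD[OF B]
  define S where "S = src A \<cdot> p"
  define T where "T = tgt A \<cdot> p"
  have S: "S \<in> hom C M X" "src A \<cdot> p = S" "src B \<cdot> q = S"
    and T: "T \<in> hom C M X" "tgt A \<cdot> p = T" "tgt B \<cdot> q = T"
    using s t Comp_hom[OF p DA(6)] Comp_hom[OF p DA(7)] by (auto simp: S_def T_def)
  have "Dom C p = M" using p by (simp add: hom_def)
  note joint = jointly_monicD[OF joint, unfolded this]
  have "\<exists>L. L \<in> Obj (cat_fiber C X) \<and> imor L = M \<and> src L = S \<and> tgt L = T \<and>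
    (\<forall>j\<in>UNIV. (L, if j then p else q, if j then A else B) \<in> Arr (cat_fiber C X))"
  proof (rule initial_lift[OF DA(3) S(1) T(1), where i = i])
    fix Z g h
    assume g: "g \<in> hom C Z M" and h: "h \<in> hom C Z M"
      and gh: "\<And>j. j \<in> UNIV \<Longrightarrow> (if j then p else q) \<cdot> g = (if j then p else q) \<cdot> h"
    from gh[of True] gh[of False] show "g = h" using joint[OF g h] by simp
  next
    show "S \<cdot> i = Ide C X" using comp_prefix[OF S(2) p DA(6) i(1)] i(2) DA(10) by simp
    show "T \<cdot> i = Ide C X" using comp_prefix[OF T(2) p DA(7) i(1)] i(2) DA(11) by simp
  next
    fix Z a b assume a: "a \<in> hom C Z M" and b: "b \<in> hom C Z M" and ab: "T \<cdot> a = S \<cdot> b"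
    note pa = Comp_hom[OF a p] and pb = Comp_hom[OF b p]
      and qa = Comp_hom[OF a q] and qb = Comp_hom[OF b q]
    have pab: "tgt A \<cdot> (p \<cdot> a) = src A \<cdot> (p \<cdot> b)"
      using ab comp_prefix[OF S(2) p DA(6) b] comp_prefix[OF T(2) p DA(7) a] by simp
    have qab: "tgt B \<cdot> (q \<cdot> a) = src B \<cdot> (q \<cdot> b)"
      using ab comp_prefix[OF S(3) q DB(6) b] comp_prefix[OF T(3) q DB(7) a] by simp
    obtain c where c: "c \<in> hom C Z M" "p \<cdot> c = icomp C A (p \<cdot> a) (p \<cdot> b)"
      "q \<cdot> c = icomp C B (q \<cdot> a) (q \<cdot> b)"
      using closed[OF a b pab qab] by blast
    note I = icomp_hom[OF DA(2) pa pb pab]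
    have "S \<cdot> c = S \<cdot> a"
      using comp_prefix[OF S(2) p DA(6) c(1)] comp_prefix[OF S(2) p DA(6) a] c(2) I(2) by simp
    moreover have "T \<cdot> c = T \<cdot> b"
      using comp_prefix[OF T(2) p DA(7) c(1)] comp_prefix[OF T(2) p DA(7) b] c(2) I(3) by simp
    ultimately show "\<exists>c\<in>hom C Z M. S \<cdot> c = S \<cdot> a \<and> T \<cdot> c = T \<cdot> b \<and>
        (\<forall>j\<in>UNIV. (if j then p else q) \<cdot> c =
          icomp C (if j then A else B) ((if j then p else q) \<cdot> a) ((if j then p else q) \<cdot> b))"
      using c by (intro bexI[of _ c]) auto
  qed (use A B S T p q i in auto)
  then obtain L where L: "L \<in> Obj (cat_fiber C X)" "imor L = M"
    "\<And>j. (L, if j then p else q, if j then A else B) \<in> Arr (cat_fiber C X)" by blast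
  from L(3)[of True] L(3)[of False] L show ?thesis by auto
qed

lemma pair_functoriality_reflected:
  assumes p: "(L, p, A) \<in> Arr (cat_fiber C X)" and q: "(L, q, B) \<in> Arr (cat_fiber C X)"
    and joint: "jointly_monic C p q"
    and k: "k \<in> hom C (imor W) (imor L)"
    and pk: "(W, p \<cdot> k, A) \<in> Arr (cat_fiber C X)" and qk: "(W, q \<cdot> k, B) \<in> Arr (cat_fiber C X)"
  shows "(W, k, L) \<in> Arr (cat_fiber C X)"
proof (rule functoriality_reflected[where J = UNIV and
      p = "\<lambda>j. if j then p else q" and A = "\<lambda>j. if j then A else B"])
  note P = fiber_arrD[OF p] note PK = fiber_arrD[OF pk]
  show "W \<in> Obj (cat_fiber C X)" "L \<in> Obj (cat_fiber C X)" using P PK by auto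
  show "(L, if j then p else q, if j then A else B) \<in> Arr (cat_fiber C X)" for j
    using p q by simp
  show "(W, (if j then p else q) \<cdot> k, if j then A else B) \<in> Arr (cat_fiber C X)" for j
    using pk qk by simp
  show "src L \<cdot> k = src W" "tgt L \<cdot> k = tgt W" using P(8,9)[OF k] PK(4,5) by auto
  show "k \<in> hom C (imor W) (imor L)" by fact
  have d: "Dom C p = imor L" using P(3) by (simp add: hom_def)
  fix Z g h assume "g \<in> hom C Z (imor L)" "h \<in> hom C Z (imor L)"
    and gh: "\<And>j. j \<in> UNIV \<Longrightarrow> (if j then p else q) \<cdot> g = (if j then p else q) \<cdot> h"
  then show "g = h" using jointly_monicD[OF joint] d gh[of True] gh[of False] by auto
qed

text \<open>The square is a pullback in \<open>C\<close>, yet its corner is a category over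
  \<open>X\<close>, hence a stage that is admissible in both categories. Identities and composites
  are formed componentwise and match because \<open>f\<close> and \<open>g\<close> are
  functors.\<close>

lemma fiber_pullback_exists:
  assumes f: "(A, f, B) \<in> Arr (cat_fiber C X)" and g: "(A', g, B) \<in> Arr (cat_fiber C X)"
  shows "\<exists>P p q. (P, p, A) \<in> Arr (cat_fiber C X) \<and> (P, q, A') \<in> Arr (cat_fiber C X) \<and>
    is_pullback C p q f g"
proof -
  note F = fiber_arrD[OF f] note G = fiber_arrD[OF g]
  obtain p q where pb: "is_pullback C p q f g" using pullback_exists[OF F(3) G(3)] by blast
  have d: "Dom C f = imor A" "Dom C g = imor A'" using F G by (auto simp: hom_def)
  note PB = pullbackD[OF pb, unfolded d]
  have sq: "f \<cdot> (p \<cdot> a) = g \<cdot> (q \<cdot> a)" if "a \<in> hom C Z (Dom C p)" for Z a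
    using square_prefix[OF PB(3,1) F(3) PB(2) G(3) that] .
  obtain i where i: "i \<in> hom C X (Dom C p)" "p \<cdot> i = idn A" "q \<cdot> i = idn A'"
    using PB(4)[of "idn A" X "idn A'"] fiber_objD(8)[OF F(1)] fiber_objD(8)[OF G(1)] F(6) G(6)
    by auto
  have "\<exists>L. L \<in> Obj (cat_fiber C X) \<and> imor L = Dom C p \<and> (L, p, A) \<in> Arr (cat_fiber C X) \<and>
      (L, q, A') \<in> Arr (cat_fiber C X)"
  proof (rule pair_lift[OF F(1) G(1) PB(1,2) _ _ PB(5) i])
    show "src A \<cdot> p = src A' \<cdot> q" "tgt A \<cdot> p = tgt A' \<cdot> q"
      using F(8,9)[OF PB(1)] G(8,9)[OF PB(2)] PB(3) by auto
    fix Z a b assume ab: "a \<in> hom C Z (Dom C p)" "b \<in> hom C Z (Dom C p)"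
      "tgt A \<cdot> (p \<cdot> a) = src A \<cdot> (p \<cdot> b)" "tgt A' \<cdot> (q \<cdot> a) = src A' \<cdot> (q \<cdot> b)"
    note pa = Comp_hom[OF ab(1) PB(1)] and pb = Comp_hom[OF ab(2) PB(1)]
      and qa = Comp_hom[OF ab(1) PB(2)] and qb = Comp_hom[OF ab(2) PB(2)]
    have "f \<cdot> icomp C A (p \<cdot> a) (p \<cdot> b) = g \<cdot> icomp C A' (q \<cdot> a) (q \<cdot> b)"
      using F(7)[OF pa pb ab(3)] G(7)[OF qa qb ab(4)] sq[OF ab(1)] sq[OF ab(2)] by simp
    then show "\<exists>c\<in>hom C Z (Dom C p). p \<cdot> c = icomp C A (p \<cdot> a) (p \<cdot> b) \<and>
        q \<cdot> c = icomp C A' (q \<cdot> a) (q \<cdot> b)"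
      using PB(4) icomp_hom(1)[OF fiber_objD(2)[OF F(1)] pa pb ab(3)]
        icomp_hom(1)[OF fiber_objD(2)[OF G(1)] qa qb ab(4)] by blast
  qed
  then show ?thesis using pb by blast
qed

text \<open>The kernel of a pair of functors over \<open>X\<close>, formed in \<open>C\<close>, is again a category over \<open>X\<close>, so
  that it can be used to test joint monicity.\<close>

lemma fiber_jointly_monic_descends:
  assumes f: "(R, f, A) \<in> Arr (cat_fiber C X)" and g: "(R, g, B) \<in> Arr (cat_fiber C X)"
    and joint: "jointly_monic (cat_fiber C X) (R, f, A) (R, g, B)"
  shows "jointly_monic C f g"
proof -
  note F = fiber_arrD[OF f] note G = fiber_arrD[OF g] note R = fiber_objD[OF F(1)]
  have d: "Dom C f = imor R" "Dom C g = imor R" using F G by (auto simp: hom_def)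
  obtain p q where pb: "is_pullback C p q f f" using pullback_exists[OF F(3,3)] by blast
  note PB = pullbackD[OF pb, unfolded d]
  \<comment> \<open>\<open>K\<close> is cut out of the kernel pair of \<open>f\<close> by equality
    under \<open>g\<close>, so it classifies exactly the pairs that \<open>f\<close> and
    \<open>g\<close> jointly fail to separate.\<close>
  obtain K e where e: "e \<in> hom C K (Dom C p)" "(g \<cdot> p) \<cdot> e = (g \<cdot> q) \<cdot> e"
    "\<And>Z a. \<lbrakk>a \<in> hom C Z (Dom C p); (g \<cdot> p) \<cdot> a = (g \<cdot> q) \<cdot> a\<rbrakk> \<Longrightarrow>
      \<exists>!w. w \<in> hom C Z K \<and> e \<cdot> w = a"
    using joint_equalizer_exists[OF Comp_hom[OF PB(1) G(3)] Comp_hom[OF PB(2) G(3)]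
        Comp_hom[OF PB(1) G(3)] Comp_hom[OF PB(2) G(3)]] by blast
  define k where "k = p \<cdot> e"
  define l where "l = q \<cdot> e"
  have k: "k \<in> hom C K (imor R)" and l: "l \<in> hom C K (imor R)"
    using Comp_hom[OF e(1) PB(1)] Comp_hom[OF e(1) PB(2)] by (auto simp: k_def l_def)
  have fkl: "f \<cdot> k = f \<cdot> l"
    using square_prefix[OF PB(3,1) F(3) PB(2) F(3) e(1)] by (simp add: k_def l_def)
  have gkl: "g \<cdot> k = g \<cdot> l"
    using comp_prefix[OF refl PB(1) G(3) e(1)] comp_prefix[OF refl PB(2) G(3) e(1)] e(2)
    by (simp add: k_def l_def)
  have univ: "\<exists>w\<in>hom C Z K. k \<cdot> w = a \<and> l \<cdot> w = b"
    if ab: "a \<in> hom C Z (imor R)" "b \<in> hom C Z (imor R)" "f \<cdot> a = f \<cdot> b" "g \<cdot> a = g \<cdot> b" for Z a b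
  proof -
    obtain v where v: "v \<in> hom C Z (Dom C p)" "p \<cdot> v = a" "q \<cdot> v = b" using PB(4)[OF ab(1-3)] by blast
    have "(g \<cdot> p) \<cdot> v = (g \<cdot> q) \<cdot> v"
      using comp_prefix[OF refl PB(1) G(3) v(1)] comp_prefix[OF refl PB(2) G(3) v(1)] v ab(4) by simp
    then obtain w where w: "w \<in> hom C Z K" "e \<cdot> w = v" using e(3)[OF v(1)] by blast
    then show ?thesis
      using comp_prefix[OF refl e(1) PB(1) w(1)] comp_prefix[OF refl e(1) PB(2) w(1)] v
      by (intro bexI[of _ w]) (auto simp: k_def l_def)
  qed
  have kl: "jointly_monic C k l"
    unfolding jointly_monic_def
  proof (intro allI ballI impI)
    fix Z x y assume "x \<in> hom C Z (Dom C k)" "y \<in> hom C Z (Dom C k)"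
      and xy: "k \<cdot> x = k \<cdot> y \<and> l \<cdot> x = l \<cdot> y"
    then have x: "x \<in> hom C Z K" and y: "y \<in> hom C Z K" using k by (auto simp: hom_def)
    have "p \<cdot> (e \<cdot> x) = p \<cdot> (e \<cdot> y)" "q \<cdot> (e \<cdot> x) = q \<cdot> (e \<cdot> y)"
      using comp_prefix[OF refl e(1) PB(1) x] comp_prefix[OF refl e(1) PB(2) x]
        comp_prefix[OF refl e(1) PB(1) y] comp_prefix[OF refl e(1) PB(2) y] xy
      by (auto simp: k_def l_def)
    then have ey: "e \<cdot> x = e \<cdot> y"
      using jointly_monicD[OF PB(5) Comp_hom[OF x e(1)] Comp_hom[OF y e(1)]] by blast
    have "(g \<cdot> p) \<cdot> (e \<cdot> x) = (g \<cdot> q) \<cdot> (e \<cdot> x)"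
      by (rule square_prefix[OF e(2,1) Comp_hom[OF PB(1) G(3)] e(1) Comp_hom[OF PB(2) G(3)] x])
    from e(3)[OF Comp_hom[OF x e(1)] this] show "x = y" using x y ey by auto
  qed
  obtain i where i: "i \<in> hom C X K" "k \<cdot> i = idn R" "l \<cdot> i = idn R"
    using univ[OF R(8) R(8)] by blast
  have "\<exists>L. L \<in> Obj (cat_fiber C X) \<and> imor L = K \<and> (L, k, R) \<in> Arr (cat_fiber C X) \<and>
      (L, l, R) \<in> Arr (cat_fiber C X)"
  proof (rule pair_lift[OF F(1) F(1) k l _ _ kl i])
    show "src R \<cdot> k = src R \<cdot> l" "tgt R \<cdot> k = tgt R \<cdot> l"
      using F(8,9)[OF k] F(8,9)[OF l] fkl by auto
    fix Z a b assume ab: "a \<in> hom C Z K" "b \<in> hom C Z K"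
      "tgt R \<cdot> (k \<cdot> a) = src R \<cdot> (k \<cdot> b)" "tgt R \<cdot> (l \<cdot> a) = src R \<cdot> (l \<cdot> b)"
    note ka = Comp_hom[OF ab(1) k] and kb = Comp_hom[OF ab(2) k]
      and la = Comp_hom[OF ab(1) l] and lb = Comp_hom[OF ab(2) l]
    have "f \<cdot> icomp C R (k \<cdot> a) (k \<cdot> b) = f \<cdot> icomp C R (l \<cdot> a) (l \<cdot> b)"
      using F(7)[OF ka kb ab(3)] F(7)[OF la lb ab(4)]
        square_prefix[OF fkl k F(3) l F(3) ab(1)] square_prefix[OF fkl k F(3) l F(3) ab(2)] by simp
    moreover have "g \<cdot> icomp C R (k \<cdot> a) (k \<cdot> b) = g \<cdot> icomp C R (l \<cdot> a) (l \<cdot> b)"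
      using G(7)[OF ka kb ab(3)] G(7)[OF la lb ab(4)]
        square_prefix[OF gkl k G(3) l G(3) ab(1)] square_prefix[OF gkl k G(3) l G(3) ab(2)] by simp
    ultimately show "\<exists>c\<in>hom C Z K. k \<cdot> c = icomp C R (k \<cdot> a) (k \<cdot> b) \<and>
        l \<cdot> c = icomp C R (l \<cdot> a) (l \<cdot> b)"
      using univ icomp_hom(1)[OF R(2) ka kb ab(3)] icomp_hom(1)[OF R(2) la lb ab(4)] by blast
  qed
  then obtain L where L: "(L, k, R) \<in> Arr (cat_fiber C X)" "(L, l, R) \<in> Arr (cat_fiber C X)" by blast
  \<comment> \<open>The two legs of the kernel are functors that \<open>f\<close> and
    \<open>g\<close> do not separate, so the hypothesis in the fiber makes them equal. Every
    unseparated pair in \<open>C\<close> factors through \<open>(k, l)\<close> and therefore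
    collapses too.\<close>
  have "(L, k, R) = (L, l, R)"
    by (rule jointly_monicD[OF joint, of _ L])
      (use L fkl gkl in \<open>auto simp: fiber_simps triple_fiber_hom_iff\<close>)
  then have "k = l" by simp
  then show ?thesis
    unfolding jointly_monic_def d using univ by blast
qed

lemma fiber_jointly_monic_ascends:
  assumes "(R, f, A) \<in> Arr (cat_fiber C X)" "jointly_monic C f g"
  shows "jointly_monic (cat_fiber C X) (R, f, A) (R, g, B)"
proof -
  have d: "Dom C f = imor R" using fiber_arrD(3)[OF assms(1)] by (simp add: hom_def)
  note joint = jointly_monicD[OF assms(2), unfolded d]
  show ?thesis
    unfolding jointly_monic_def
  proof (intro allI ballI impI)
    fix Z x' y'
    assume "x' \<in> hom (cat_fiber C X) Z (Dom (cat_fiber C X) (R, f, A))"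
      "y' \<in> hom (cat_fiber C X) Z (Dom (cat_fiber C X) (R, f, A))"
      and e: "Comp (cat_fiber C X) (R, f, A) x' = Comp (cat_fiber C X) (R, f, A) y' \<and>
        Comp (cat_fiber C X) (R, g, B) x' = Comp (cat_fiber C X) (R, g, B) y'"
    then obtain x y where x: "x' = (Z, x, R)" "(Z, x, R) \<in> Arr (cat_fiber C X)"
      and y: "y' = (Z, y, R)" "(Z, y, R) \<in> Arr (cat_fiber C X)"
      by (auto simp: fiber_hom_iff fiber_simps)
    have "x = y" using joint[OF fiber_arrD(3)[OF x(2)] fiber_arrD(3)[OF y(2)]] e x y
      by (simp add: fiber_simps)
    then show "x' = y'" using x y by simp
  qed
qed

section \<open>Relations in the fiber compared with relations in \<open>C\<close>\<close>

lemma fiber_relationE: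
  assumes "is_relation (cat_fiber C X) A S"
  obtains R p q where "S = ((R, p, A), (R, q, A))" "(R, p, A) \<in> Arr (cat_fiber C X)"
    "(R, q, A) \<in> Arr (cat_fiber C X)" "jointly_monic C p q"
proof -
  interpret F: category "cat_fiber C X" by (rule fiber_category)
  have S: "fst S \<in> hom (cat_fiber C X) (apex (cat_fiber C X) S) A"
    "snd S \<in> hom (cat_fiber C X) (apex (cat_fiber C X) S) A"
    "jointly_monic (cat_fiber C X) (fst S) (snd S)"
    using assms by (auto simp: F.is_relation_iff)
  obtain p q where p: "fst S = (apex (cat_fiber C X) S, p, A)" "fst S \<in> Arr (cat_fiber C X)"
    and q: "snd S = (apex (cat_fiber C X) S, q, A)" "snd S \<in> Arr (cat_fiber C X)"
    using S by (auto simp: fiber_hom_iff)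
  define R where "R = apex (cat_fiber C X) S"
  have S': "S = ((R, p, A), (R, q, A))" using p(1) q(1) by (simp add: prod_eq_iff R_def)
  show thesis
    using that[OF S'] p q S(3) fiber_jointly_monic_descends[of R p A X q A] by (simp add: S')
qed

text \<open>A witness found in \<open>C\<close> is automatically a functor, since its composites
  with the jointly monic functors \<open>p\<close> and \<open>q\<close> are the functors
  \<open>a\<close> and \<open>b\<close>.\<close>

lemma related_fiber_iff:
  assumes p: "(R, p, A) \<in> Arr (cat_fiber C X)" and q: "(R, q, A) \<in> Arr (cat_fiber C X)"
    and joint: "jointly_monic C p q"
    and a: "(W, a, A) \<in> Arr (cat_fiber C X)" and b: "(W, b, A) \<in> Arr (cat_fiber C X)"
  shows "related (cat_fiber C X) ((R, p, A), (R, q, A)) (W, a, A) (W, b, A) \<longleftrightarrow> related C (p, q) a b"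
proof
  assume "related (cat_fiber C X) ((R, p, A), (R, q, A)) (W, a, A) (W, b, A)"
  then obtain h where "(W, h, R) \<in> Arr (cat_fiber C X)" "p \<cdot> h = a" "q \<cdot> h = b"
    unfolding related_def by (auto simp: fiber_simps fiber_hom_iff)
  then show "related C (p, q) a b"
    using fiber_arrD(3)[of W h R X] fiber_arrD(3)[OF p] unfolding related_def
    by (auto simp: hom_def)
next
  assume "related C (p, q) a b"
  then obtain h where h: "h \<in> hom C (imor W) (imor R)" "p \<cdot> h = a" "q \<cdot> h = b"
    using fiber_arrD(3)[OF a] fiber_arrD(3)[OF p] unfolding related_def by (auto simp: hom_def)
  then have "(W, h, R) \<in> Arr (cat_fiber C X)"
    using pair_functoriality_reflected[OF p q joint h(1)] a b by simp
  then show "related (cat_fiber C X) ((R, p, A), (R, q, A)) (W, a, A) (W, b, A)"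
    using h unfolding related_def
    by (intro bexI[of _ "(W, h, R)"]) (auto simp: fiber_simps triple_fiber_hom_iff)
qed

text \<open>Functors into \<open>A\<close> are particular generalized elements of
  \<open>imor A\<close>, so the laws in \<open>C\<close> specialize to them.\<close>

lemma fiber_equivalence_ascends:
  assumes p: "(R, p, A) \<in> Arr (cat_fiber C X)" and q: "(R, q, A) \<in> Arr (cat_fiber C X)"
    and eq: "internal_equivalence C (imor A) (p, q)"
  shows "internal_equivalence (cat_fiber C X) A ((R, p, A), (R, q, A))"
proof -
  interpret F: category "cat_fiber C X" by (rule fiber_category)
  have joint: "jointly_monic C p q" using internal_equivalenceD(1)[OF eq] by (simp add: is_relation_iff)
  note rel = related_fiber_iff[OF p q joint]
  note E = internal_equivalenceD[OF eq]
  have H: "\<exists>x. x' = (Z, x, A) \<and> (Z, x, A) \<in> Arr (cat_fiber C X) \<and> x \<in> hom C (imor Z) (imor A)"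
    if "x' \<in> hom (cat_fiber C X) Z A" for Z x'
    using that fiber_arrD(3) by (auto simp: fiber_hom_iff)
  show ?thesis
  proof (rule F.internal_equivalenceI)
    show "is_relation (cat_fiber C X) A ((R, p, A), (R, q, A))"
      unfolding F.is_relation_iff using p q fiber_jointly_monic_ascends[OF p joint]
      by (simp add: triple_fiber_hom_iff fiber_simps)
  next
    fix Z x assume "x \<in> hom (cat_fiber C X) Z A"
    then show "related (cat_fiber C X) ((R, p, A), (R, q, A)) x x"
      using H rel E(2) by blast
  next
    fix Z x y assume "x \<in> hom (cat_fiber C X) Z A" "y \<in> hom (cat_fiber C X) Z A"
      "related (cat_fiber C X) ((R, p, A), (R, q, A)) x y"
    then show "related (cat_fiber C X) ((R, p, A), (R, q, A)) y x"
      using H rel E(3) by (metis (no_types, lifting))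
  next
    fix Z x y z assume "x \<in> hom (cat_fiber C X) Z A" "y \<in> hom (cat_fiber C X) Z A"
      "z \<in> hom (cat_fiber C X) Z A"
      "related (cat_fiber C X) ((R, p, A), (R, q, A)) x y"
      "related (cat_fiber C X) ((R, p, A), (R, q, A)) y z"
    then show "related (cat_fiber C X) ((R, p, A), (R, q, A)) x z"
      using H rel E(4) by (metis (no_types, lifting))
  qed
qed

text \<open>Each law has a generic instance at a stage in the fiber: the identity of
  \<open>A\<close> for reflexivity, the legs \<open>p\<close> and \<open>q\<close> at stage
  \<open>R\<close> for symmetry, and the pullback of \<open>q\<close> and \<open>p\<close> for
  transitivity. The law for arbitrary elements of \<open>C\<close> follows by
  precomposition.\<close>

lemma fiber_equivalence_descends:
  assumes p: "(R, p, A) \<in> Arr (cat_fiber C X)" and q: "(R, q, A) \<in> Arr (cat_fiber C X)"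
    and joint: "jointly_monic C p q"
    and eq: "internal_equivalence (cat_fiber C X) A ((R, p, A), (R, q, A))"
  shows "internal_equivalence C (imor A) (p, q)"
proof -
  interpret F: category "cat_fiber C X" by (rule fiber_category)
  note P = fiber_arrD[OF p] note Q = fiber_arrD[OF q]
  note rel = related_fiber_iff[OF p q joint]
  note E = F.internal_equivalenceD[OF eq]
  have d: "Dom C p = imor R" using P(3) by (simp add: hom_def)
  have R: "is_relation C (imor A) (p, q)" using P Q joint by (simp add: is_relation_iff d)
  have pq: "related C (p, q) (p \<cdot> h) (q \<cdot> h)" if "h \<in> hom C Z (imor R)" for Z h
    using relatedI[of h Z "(p, q)" "imor A"] that P(3) d by simp
  have Rid: "Ide C (imor R) \<in> hom C (imor R) (imor R)" using P(1) fiber_objD(4) Ide_hom by blast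
  \<comment> \<open>The generic related pair, witnessed by the identity of the apex.\<close>
  have pq1: "related C (p, q) p q" using pq[OF Rid] Comp_Ide P(3) Q(3) by simp
  show ?thesis
  proof (rule internal_equivalenceI[OF R])
    fix Z x assume x: "x \<in> hom C Z (imor A)"
    have id: "(A, Ide C (imor A), A) \<in> Arr (cat_fiber C X)"
      using F.Ide_hom[OF P(2)] by (simp add: fiber_simps triple_fiber_hom_iff)
    have "related C (p, q) (Ide C (imor A)) (Ide C (imor A))"
      using E(2)[of "(A, Ide C (imor A), A)" A] id rel[OF id id] by (simp add: triple_fiber_hom_iff)
    from related_comp[OF this fiber_arrD(3)[OF id] R x]
    show "related C (p, q) x x" using Ide_Comp[OF x] by simp
  next
    fix Z x y assume x: "x \<in> hom C Z (imor A)" and y: "y \<in> hom C Z (imor A)"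
      and xy: "related C (p, q) x y"
    have "related C (p, q) q p"
      using E(3)[of "(R, p, A)" R "(R, q, A)"] rel[OF p q] rel[OF q p] pq1 p q
      by (simp add: triple_fiber_hom_iff)
    moreover obtain h where "h \<in> hom C Z (imor R)" "p \<cdot> h = x" "q \<cdot> h = y"
      using relatedE[OF xy x] d by auto
    ultimately show "related C (p, q) y x" using related_comp[OF _ Q(3) R] by blast
  next
    fix Z x y z assume x: "x \<in> hom C Z (imor A)" and y: "y \<in> hom C Z (imor A)"
      and z: "z \<in> hom C Z (imor A)"
      and xy: "related C (p, q) x y" and yz: "related C (p, q) y z"
    obtain h where h: "h \<in> hom C Z (imor R)" "p \<cdot> h = x" "q \<cdot> h = y"
      using relatedE[OF xy x] d by auto
    obtain k where k: "k \<in> hom C Z (imor R)" "p \<cdot> k = y" "q \<cdot> k = z"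
      using relatedE[OF yz y] d by auto
    \<comment> \<open>\<open>L\<close> classifies chains of two related pairs; the given chain
      \<open>h\<close>, \<open>k\<close> will be the restriction of the generic one along
      \<open>w\<close>.\<close>
    obtain L a b where a: "(L, a, R) \<in> Arr (cat_fiber C X)" and b: "(L, b, R) \<in> Arr (cat_fiber C X)"
      and pb: "is_pullback C a b q p"
      using fiber_pullback_exists[OF q p] by blast
    note a3 = fiber_arrD(3)[OF a] and b3 = fiber_arrD(3)[OF b]
    have da: "Dom C a = imor L" "Dom C q = imor R" using a3 Q(3) by (auto simp: hom_def)
    note PB = pullbackD[OF pb, unfolded d da]
    obtain w where w: "w \<in> hom C Z (imor L)" "a \<cdot> w = h" "b \<cdot> w = k"
      using PB(4)[OF h(1) k(1)] h k by auto
    have arr: "(L, g \<cdot> l, A) \<in> Arr (cat_fiber C X)"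
      if "(R, g, A) \<in> Arr (cat_fiber C X)" "(L, l, R) \<in> Arr (cat_fiber C X)" for g l
      using F.Comp_hom[of "(L, l, R)" L R "(R, g, A)" A] that
      by (simp add: triple_fiber_hom_iff fiber_simps)
    note pa = arr[OF p a] and qa = arr[OF q a] and pb' = arr[OF p b] and qb = arr[OF q b]
    have "related C (p, q) (p \<cdot> a) (q \<cdot> a)" "related C (p, q) (q \<cdot> a) (q \<cdot> b)"
      using pq[OF a3] pq[OF b3] PB(3) by auto
    then have "related C (p, q) (p \<cdot> a) (q \<cdot> b)"
      using E(4)[of "(L, p \<cdot> a, A)" L "(L, q \<cdot> a, A)" "(L, q \<cdot> b, A)"] pa qa qb
        rel[OF pa qa] rel[OF qa qb] rel[OF pa qb] by (simp add: triple_fiber_hom_iff)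
    from related_comp[OF this fiber_arrD(3)[OF pa] R w(1)]
    show "related C (p, q) x z"
      using comp_prefix[OF refl a3 P(3) w(1)] comp_prefix[OF refl b3 Q(3) w(1)] w h k by simp
  qed
qed

text \<open>This removes the chosen inverse images. The pullback condition says that an element of
  \<open>T\<close> starting in the subobject also ends there; the inclusion in \<open>S\<close> adds
  that the two preimages under \<open>u\<close> are related by \<open>S\<close>.\<close>

lemma saturating_relations_iff:
  assumes u: "monic C u" and S: "is_relation C (Dom C u) S"
  shows "T \<in> saturating_relations C u S \<longleftrightarrow> internal_equivalence C (Cod C u) T \<and>
    (\<forall>Z. \<forall>a\<in>hom C Z (Dom C u). \<forall>t\<in>hom C Z (apex C T). fst T \<cdot> t = u \<cdot> a \<longrightarrow>
       (\<exists>b\<in>hom C Z (Dom C u). snd T \<cdot> t = u \<cdot> b \<and> related C S a b))"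
    (is "_ \<longleftrightarrow> ?eq \<and> ?sat")
proof (cases ?eq)
  case False
  then show ?thesis by (auto simp: saturating_relations_def)
next
  case True
  have uh: "u \<in> hom C (Dom C u) (Cod C u)" using u arr_hom by (auto simp: monic_def)
  have T: "fst T \<in> hom C (apex C T) (Cod C u)" "snd T \<in> hom C (apex C T) (Cod C u)"
    using internal_equivalenceD(1)[OF True] by (auto simp: is_relation_iff)
  have um: "a = b" if "a \<in> hom C Z (Dom C u)" "b \<in> hom C Z (Dom C u)" "u \<cdot> a = u \<cdot> b" for Z a b
    using u that jointly_monicD[of C u u a Z b] by (simp add: monic_iff)
  have "saturated C u T \<and> inverse_image_le C u T S \<longleftrightarrow> ?sat"
  proof
    assume sat: "saturated C u T \<and> inverse_image_le C u T S"
    then obtain W k where W: "is_inverse_image C u T W k" and pb: "is_pullback C (fst W) k u (fst T)"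
      by (auto simp: saturated_def)
    obtain W' k' where W': "is_inverse_image C u T W' k'" and le: "rel_le C W' S"
      using sat by (auto simp: inverse_image_le_def)
    note PB = pullbackD[OF pb]
    show ?sat
    proof (intro allI ballI impI)
      fix Z a t assume a: "a \<in> hom C Z (Dom C u)" and t: "t \<in> hom C Z (apex C T)"
        and at: "fst T \<cdot> t = u \<cdot> a"
      obtain w where w: "w \<in> hom C Z (apex C W)" "fst W \<cdot> w = a" "k \<cdot> w = t"
        using PB(4)[OF a t at[symmetric]] by blast
      have Wh: "snd W \<in> hom C (apex C W) (Dom C u)" and Wk: "k \<in> hom C (apex C W) (apex C T)"
        "snd T \<cdot> k = u \<cdot> snd W"
        using W by (auto simp: is_inverse_image_def is_relation_def)
      define b where "b = snd W \<cdot> w"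
      have b: "b \<in> hom C Z (Dom C u)" using Comp_hom[OF w(1) Wh] by (simp add: b_def)
      have bt: "snd T \<cdot> t = u \<cdot> b"
        using square_prefix[OF Wk(2,1) T(2) Wh uh w(1)] w(3) by (simp add: b_def)
      \<comment> \<open>Saturation and inclusion may come with different inverse images
        \<open>W\<close> and \<open>W'\<close>; the pair \<open>(a, b)\<close> found through the
        first is lifted to the second.\<close>
      obtain v where v: "v \<in> hom C Z (apex C W')" "fst W' \<cdot> v = a" "snd W' \<cdot> v = b"
        using W' a b t at bt hom_obj[OF a] unfolding is_inverse_image_def by blast
      obtain h where h: "h \<in> hom C (apex C W') (apex C S)" "fst S \<cdot> h = fst W'" "snd S \<cdot> h = snd W'"
        using le by (auto simp: rel_le_def)
      have Sh: "fst S \<in> hom C (apex C S) (Dom C u)" "snd S \<in> hom C (apex C S) (Dom C u)"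
        using S by (auto simp: is_relation_iff)
      have "related C S a b"
        by (rule relatedI[OF Comp_hom[OF v(1) h(1)] Sh(1)])
          (use comp_prefix[OF h(2,1) Sh(1) v(1)] comp_prefix[OF h(3,1) Sh(2) v(1)] v in auto)
      then show "\<exists>b\<in>hom C Z (Dom C u). snd T \<cdot> t = u \<cdot> b \<and> related C S a b" using b bt by blast
    qed
  next
    assume sat: ?sat
    \<comment> \<open>The pullback demanded by saturation also serves as the inverse image: its
      missing second leg \<open>w1\<close> is what the hypothesis yields at the generic element
      \<open>(w0, k)\<close>.\<close>
    obtain w0 k where pb: "is_pullback C w0 k u (fst T)" using pullback_exists[OF uh T(1)] by blast
    note PB = pullbackD[OF pb]
    obtain w1 where w1: "w1 \<in> hom C (Dom C w0) (Dom C u)" "snd T \<cdot> k = u \<cdot> w1" "related C S w0 w1"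
      using sat[rule_format, OF PB(1,2) PB(3)[symmetric]] by blast
    have W: "is_inverse_image C u T (w0, w1) k"
      unfolding is_inverse_image_def is_relation_iff fst_conv snd_conv
    proof (intro conjI ballI impI)
      show "jointly_monic C w0 w1"
        unfolding jointly_monic_def
      proof (intro allI ballI impI)
        fix Z g h assume g: "g \<in> hom C Z (Dom C w0)" and h: "h \<in> hom C Z (Dom C w0)"
          and gh: "w0 \<cdot> g = w0 \<cdot> h \<and> w1 \<cdot> g = w1 \<cdot> h"
        have "fst T \<cdot> (k \<cdot> g) = fst T \<cdot> (k \<cdot> h)"
          using square_prefix[OF PB(3,1) uh PB(2) T(1) g] square_prefix[OF PB(3,1) uh PB(2) T(1) h] gh
          by simp
        moreover have "snd T \<cdot> (k \<cdot> g) = snd T \<cdot> (k \<cdot> h)"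
          using square_prefix[OF w1(2) PB(2) T(2) w1(1) uh g]
            square_prefix[OF w1(2) PB(2) T(2) w1(1) uh h] gh by simp
        ultimately have "k \<cdot> g = k \<cdot> h"
          using internal_equivalenceD(1)[OF True] jointly_monicD[of C "fst T" "snd T"]
            Comp_hom[OF g PB(2)] Comp_hom[OF h PB(2)] by (auto simp: is_relation_iff)
        then show "g = h" using jointly_monicD[OF PB(5) g h] gh by blast
      qed
      fix Z a b t assume a: "a \<in> hom C Z (Dom C u)" and b: "b \<in> hom C Z (Dom C u)"
        and t: "t \<in> hom C Z (apex C T)" and e: "fst T \<cdot> t = u \<cdot> a \<and> snd T \<cdot> t = u \<cdot> b"
      obtain w where w: "w \<in> hom C Z (Dom C w0)" "w0 \<cdot> w = a" "k \<cdot> w = t"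
        using PB(4)[OF a t] e by auto
      have "u \<cdot> (w1 \<cdot> w) = u \<cdot> b" using square_prefix[OF w1(2) PB(2) T(2) w1(1) uh w(1)] w e by simp
      then have "w1 \<cdot> w = b" using um Comp_hom[OF w(1) w1(1)] b by blast
      then show "\<exists>!w. w \<in> hom C Z (Dom C w0) \<and> w0 \<cdot> w = a \<and> w1 \<cdot> w = b \<and> k \<cdot> w = t"
        using w jointly_monicD[OF PB(5)] by (intro ex1I[of _ w]) auto
    qed (use PB w1 in auto)
    obtain h where h: "h \<in> hom C (Dom C w0) (apex C S)" "fst S \<cdot> h = w0" "snd S \<cdot> h = w1"
      using relatedE[OF w1(3) PB(1)] by blast
    then have "rel_le C (w0, w1) S" by (auto simp: rel_le_def)
    then show "saturated C u T \<and> inverse_image_le C u T S"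
      unfolding saturated_def inverse_image_le_def using W pb by (metis fst_conv)
  qed
  then show ?thesis using True by (simp add: saturating_relations_def)
qed

end


section \<open>Equivalence relations and the shifting lemma\<close>

context finitely_complete_category
begin

text \<open>Equality as an internal relation. Its inverse images are the kernel equivalences, and it
  will be the intersection of two of them in the shifting lemma.\<close>

lemma discrete_equivalence:
  assumes "B \<in> Obj C"
  shows "internal_equivalence C B (Ide C B, Ide C B)"
    and "x \<in> hom C Z B \<Longrightarrow> related C (Ide C B, Ide C B) x y \<longleftrightarrow> x = y"
proof -
  have d: "Dom C (Ide C B) = B" using assms by simp
  have R: "is_relation C B (Ide C B, Ide C B)"
    unfolding is_relation_iff jointly_monic_def fst_conv snd_conv d
    using Ide_hom[OF assms] Ide_Comp by metis
  have rel: "related C (Ide C B, Ide C B) x y \<longleftrightarrow> x = y" if x: "x \<in> hom C Z B" for Z x y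
  proof
    assume "related C (Ide C B, Ide C B) x y"
    from relatedE[OF this x] show "x = y" by auto
  next
    assume "x = y"
    then show "related C (Ide C B, Ide C B) x y"
      using relatedI[of x Z "(Ide C B, Ide C B)" B x y] x d Ide_hom[OF assms] Ide_Comp[OF x] by simp
  qed
  show "x \<in> hom C Z B \<Longrightarrow> related C (Ide C B, Ide C B) x y \<longleftrightarrow> x = y" by (rule rel)
  show "internal_equivalence C B (Ide C B, Ide C B)"
    by (rule internal_equivalenceI[OF R]) (auto simp: rel)
qed

text \<open>Two successive pullbacks along \<open>m\<close>, one for each leg of \<open>T\<close>,
  take the place of a single pullback along \<open>m \<times> m\<close>. The intended
  \<open>m\<close> is the composition of an internal category.\<close>

lemma inverse_image_equivalence_exists:
  assumes m: "m \<in> hom C P B" and T: "internal_equivalence C B T"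
  shows "\<exists>K. internal_equivalence C P K \<and>
    (\<forall>Z. \<forall>x\<in>hom C Z P. \<forall>y\<in>hom C Z P. related C K x y \<longleftrightarrow> related C T (m \<cdot> x) (m \<cdot> y))"
proof -
  note E = internal_equivalenceD[OF T]
  have Th: "fst T \<in> hom C (apex C T) B" "snd T \<in> hom C (apex C T) B"
    and Tj: "jointly_monic C (fst T) (snd T)"
    using E(1) by (auto simp: is_relation_iff)
  obtain w k where wk: "is_pullback C w k m (fst T)" using pullback_exists[OF m Th(1)] by blast
  have dm: "Dom C m = P" using m by (simp add: hom_def)
  note W = pullbackD[OF wk, unfolded dm]
  note tk = Comp_hom[OF W(2) Th(2)]
  obtain l v where lv: "is_pullback C l v (snd T \<cdot> k) m" using pullback_exists[OF tk m] by blast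
  have dtk: "Dom C (snd T \<cdot> k) = Dom C w" using tk by (simp add: hom_def)
  note L = pullbackD[OF lv, unfolded dm dtk]
  define K where "K = (w \<cdot> l, v)"
  have wl: "w \<cdot> l \<in> hom C (Dom C l) P" using Comp_hom[OF L(1) W(1)] .
  have dK: "apex C K = Dom C l" using wl by (simp add: K_def hom_def)
  have rel: "related C K x y \<longleftrightarrow> related C T (m \<cdot> x) (m \<cdot> y)"
    if x: "x \<in> hom C Z P" and y: "y \<in> hom C Z P" for Z x y
  proof
    assume "related C K x y"
    then obtain h where h: "h \<in> hom C Z (Dom C l)" "(w \<cdot> l) \<cdot> h = x" "v \<cdot> h = y"
      using relatedE[OF _ x] dK by (metis K_def fst_conv snd_conv)
    note lh = Comp_hom[OF h(1) L(1)]
    have "fst T \<cdot> (k \<cdot> (l \<cdot> h)) = m \<cdot> x"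
      using square_prefix[OF W(3,1) m W(2) Th(1) lh] comp_prefix[OF refl L(1) W(1) h(1)] h by simp
    moreover have "snd T \<cdot> (k \<cdot> (l \<cdot> h)) = m \<cdot> y"
      using square_prefix[OF L(3,1) tk L(2) m h(1)] comp_prefix[OF refl W(2) Th(2) lh] h by simp
    ultimately show "related C T (m \<cdot> x) (m \<cdot> y)"
      using relatedI[OF Comp_hom[OF lh W(2)] Th(1)] by blast
  next
    assume "related C T (m \<cdot> x) (m \<cdot> y)"
    then obtain t where t: "t \<in> hom C Z (apex C T)" "fst T \<cdot> t = m \<cdot> x" "snd T \<cdot> t = m \<cdot> y"
      using relatedE Comp_hom[OF x m] by metis
    obtain r where r: "r \<in> hom C Z (Dom C w)" "w \<cdot> r = x" "k \<cdot> r = t"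
      using W(4)[OF x t(1)] t by auto
    have "(snd T \<cdot> k) \<cdot> r = m \<cdot> y" using comp_prefix[OF refl W(2) Th(2) r(1)] r t by simp
    then obtain h where h: "h \<in> hom C Z (Dom C l)" "l \<cdot> h = r" "v \<cdot> h = y"
      using L(4)[OF r(1) y] by blast
    have "(w \<cdot> l) \<cdot> h = x" using comp_prefix[OF refl L(1) W(1) h(1)] h r by simp
    then show "related C K x y"
      using relatedI[of h Z K P x y] h wl dK by (simp add: K_def)
  qed
  have "jointly_monic C (w \<cdot> l) v"
    unfolding jointly_monic_def
  proof (intro allI ballI impI)
    fix Z g h assume "g \<in> hom C Z (Dom C (w \<cdot> l))" "h \<in> hom C Z (Dom C (w \<cdot> l))"
      and gh: "(w \<cdot> l) \<cdot> g = (w \<cdot> l) \<cdot> h \<and> v \<cdot> g = v \<cdot> h"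
    then have g: "g \<in> hom C Z (Dom C l)" and h: "h \<in> hom C Z (Dom C l)"
      using wl by (auto simp: hom_def)
    note lg = Comp_hom[OF g L(1)] and lh = Comp_hom[OF h L(1)]
    have w: "w \<cdot> (l \<cdot> g) = w \<cdot> (l \<cdot> h)"
      using comp_prefix[OF refl L(1) W(1) g] comp_prefix[OF refl L(1) W(1) h] gh by simp
    have "fst T \<cdot> (k \<cdot> (l \<cdot> g)) = fst T \<cdot> (k \<cdot> (l \<cdot> h))"
      using square_prefix[OF W(3,1) m W(2) Th(1) lg] square_prefix[OF W(3,1) m W(2) Th(1) lh] w
      by simp
    moreover have "snd T \<cdot> (k \<cdot> (l \<cdot> g)) = snd T \<cdot> (k \<cdot> (l \<cdot> h))"
      using square_prefix[OF L(3,1) tk L(2) m g] square_prefix[OF L(3,1) tk L(2) m h]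
        comp_prefix[OF refl W(2) Th(2) lg] comp_prefix[OF refl W(2) Th(2) lh] gh by simp
    ultimately have "k \<cdot> (l \<cdot> g) = k \<cdot> (l \<cdot> h)"
      using jointly_monicD[OF Tj Comp_hom[OF lg W(2)] Comp_hom[OF lh W(2)]] by blast
    then have "l \<cdot> g = l \<cdot> h" using jointly_monicD[OF W(5) lg lh] w by blast
    then show "g = h" using jointly_monicD[OF L(5) g h] gh by blast
  qed
  then have K: "is_relation C P K"
    using wl L(2) dK by (simp add: is_relation_iff K_def)
  have "internal_equivalence C P K"
  proof (rule internal_equivalenceI[OF K])
    fix Z x assume "x \<in> hom C Z P"
    then show "related C K x x" using rel E(2) Comp_hom[OF _ m] by blast
  next
    fix Z x y assume "x \<in> hom C Z P" "y \<in> hom C Z P" "related C K x y"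
    then show "related C K y x" using rel E(3) Comp_hom[OF _ m] by blast
  next
    fix Z x y z assume xyz: "x \<in> hom C Z P" "y \<in> hom C Z P" "z \<in> hom C Z P"
      "related C K x y" "related C K y z"
    then show "related C K x z"
      using rel E(4)[of "m \<cdot> x" Z "m \<cdot> y" "m \<cdot> z"] Comp_hom[OF _ m] by blast
  qed
  then show ?thesis using rel by blast
qed

lemma kernel_equivalence_exists:
  assumes f: "f \<in> hom C P B"
  shows "\<exists>K. internal_equivalence C P K \<and>
    (\<forall>Z. \<forall>x\<in>hom C Z P. \<forall>y\<in>hom C Z P. related C K x y \<longleftrightarrow> f \<cdot> x = f \<cdot> y)"
proof -
  have B: "B \<in> Obj C" using hom_obj[OF f] by blast
  obtain K where K: "internal_equivalence C P K"
    "\<And>Z x y. \<lbrakk>x \<in> hom C Z P; y \<in> hom C Z P\<rbrakk> \<Longrightarrow>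
      related C K x y \<longleftrightarrow> related C (Ide C B, Ide C B) (f \<cdot> x) (f \<cdot> y)"
    using inverse_image_equivalence_exists[OF f discrete_equivalence(1)[OF B]] by blast
  have "related C K x y \<longleftrightarrow> f \<cdot> x = f \<cdot> y" if "x \<in> hom C Z P" "y \<in> hom C Z P" for Z x y
    using K(2)[OF that] discrete_equivalence(2)[OF B Comp_hom[OF that(1) f]] by simp
  with K(1) show ?thesis by blast
qed

end

section \<open>Consequences of the shifting lemma\<close>

context gumm_category
begin

text \<open>The kernel pairs of two jointly monic arrows meet in the discrete relation, so that the
  shifting lemma applies to them with an arbitrary third relation, here the inverse image of \<open>T\<close>.\<close>

lemma rectangle_shift:
  assumes p: "p \<in> hom C P A" and q: "q \<in> hom C P B" and joint: "jointly_monic C p q"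
    and m: "m \<in> hom C P Y" and T: "internal_equivalence C Y T"
    and x: "x \<in> hom C Z P" and y: "y \<in> hom C Z P" and x': "x' \<in> hom C Z P" and y': "y' \<in> hom C Z P"
    and "p \<cdot> x = p \<cdot> y" "p \<cdot> x' = p \<cdot> y'" "q \<cdot> x = q \<cdot> x'" "q \<cdot> y = q \<cdot> y'"
    and "related C T (m \<cdot> x) (m \<cdot> x')"
  shows "related C T (m \<cdot> y) (m \<cdot> y')"
proof -
  have dp: "Dom C p = P" using p by (simp add: hom_def)
  have P: "P \<in> Obj C" and Z: "Z \<in> Obj C" using hom_obj p x by blast+
  obtain S where S: "internal_equivalence C P S"
    "\<And>Z x y. x \<in> hom C Z P \<Longrightarrow> y \<in> hom C Z P \<Longrightarrow> related C S x y \<longleftrightarrow> p \<cdot> x = p \<cdot> y"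
    using kernel_equivalence_exists[OF p] by blast
  obtain R where R: "internal_equivalence C P R"
    "\<And>Z x y. x \<in> hom C Z P \<Longrightarrow> y \<in> hom C Z P \<Longrightarrow> related C R x y \<longleftrightarrow> q \<cdot> x = q \<cdot> y"
    using kernel_equivalence_exists[OF q] by blast
  obtain K where K: "internal_equivalence C P K"
    "\<And>Z x y. x \<in> hom C Z P \<Longrightarrow> y \<in> hom C Z P \<Longrightarrow> related C K x y \<longleftrightarrow> related C T (m \<cdot> x) (m \<cdot> y)"
    using inverse_image_equivalence_exists[OF m T] by blast
  let ?I = "(Ide C P, Ide C P)"
  have "is_intersection C P R S ?I"
    unfolding is_intersection_def
  proof (intro conjI ballI internal_equivalenceD(1)[OF discrete_equivalence(1)[OF P]])
    fix W a b assume a: "a \<in> hom C W P" and b: "b \<in> hom C W P"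
    have "a = b" if "p \<cdot> a = p \<cdot> b" "q \<cdot> a = q \<cdot> b"
      using jointly_monicD[OF joint, unfolded dp, OF a b that] .
    then show "related C ?I a b \<longleftrightarrow> related C R a b \<and> related C S a b"
      unfolding discrete_equivalence(2)[OF P a] R(2)[OF a b] S(2)[OF a b] by auto
  qed
  moreover have "rel_le C ?I K"
  proof -
    have "related C K (Ide C P) (Ide C P)" using internal_equivalenceD(2)[OF K(1) Ide_hom[OF P]] .
    from relatedE[OF this Ide_hom[OF P]] obtain h
      where "h \<in> hom C P (apex C K)" "fst K \<cdot> h = Ide C P" "snd K \<cdot> h = Ide C P" .
    then show ?thesis using P by (auto simp: rel_le_def)
  qed
  ultimately have "\<exists>I. is_intersection C P R S I \<and> rel_le C I K" by blast
  moreover have "related C S x y" "related C S x' y'" "related C R x x'" "related C R y y'"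
    "related C K x x'"
    using R(2)[OF x x'] R(2)[OF y y'] S(2)[OF x y] S(2)[OF x' y'] K(2)[OF x x'] assms(10-14)
    by (metis+)
  ultimately have "related C K y y'"
    by (rule shifting_lemma[OF P R(1) S(1) K(1) _ Z x y x' y'])
  then show ?thesis using K(2)[OF y y'] by (rule iffD1[rotated])
qed

text \<open>Two shifts of composable pairs: along \<open>(f, 1), (f', 1), (f, g), (f', g)\<close> and along
  \<open>(1, g), (1, g'), (f', g), (f', g')\<close>.\<close>

lemma equivalence_icomp:
  assumes B: "B \<in> Obj (cat_fiber C X)" and T: "internal_equivalence C (imor B) T"
    and f: "f \<in> hom C Z (imor B)" and f': "f' \<in> hom C Z (imor B)"
    and g: "g \<in> hom C Z (imor B)" and g': "g' \<in> hom C Z (imor B)"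
    and fg: "tgt B \<cdot> f = src B \<cdot> g" and f'g: "tgt B \<cdot> f' = src B \<cdot> g"
    and gg': "src B \<cdot> g = src B \<cdot> g'"
    and Tf: "related C T f f'" and Tg: "related C T g g'"
  shows "related C T (icomp C B f g) (icomp C B f' g')"
proof -
  note D = fiber_objD[OF B]
  have pb: "is_pullback C (pairs1 C B) (pairs2 C B) (tgt B) (src B)"
    by (rule composable_pairs_pullback[OF D(6,7)])
  note P = pairs_hom[OF D(6,7)] and joint = pullbackD(5)[OF pb]
  have pair: "\<exists>w. w \<in> hom C Z (Dom C (pairs1 C B)) \<and> pairs1 C B \<cdot> w = a \<and> pairs2 C B \<cdot> w = b \<and>
      icomp C B a b = cmp B \<cdot> w"
    if "a \<in> hom C Z (imor B)" "b \<in> hom C Z (imor B)" "tgt B \<cdot> a = src B \<cdot> b" for a b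
    using composable_pair_exists[OF D(2) that] icomp_eq[OF D(2) that] by blast
  \<comment> \<open>The arrows \<open>f\<close>, \<open>f'\<close> end where \<open>g\<close>,
    \<open>g'\<close> start, so a single identity \<open>i\<close> at this common object pads all
    four of them to composable pairs.\<close>
  define i where "i = idn B \<cdot> (src B \<cdot> g)"
  have sg: "src B \<cdot> g \<in> hom C Z X" using Comp_hom[OF g D(6)] .
  have i: "i \<in> hom C Z (imor B)" using Comp_hom[OF sg D(8)] by (simp add: i_def)
  have si: "src B \<cdot> i = src B \<cdot> g" and ti: "tgt B \<cdot> i = src B \<cdot> g"
    using comp_prefix[OF D(10,8,6) sg] comp_prefix[OF D(11,8,7) sg] Ide_Comp[OF sg]
    by (auto simp: i_def)
  have ifi: "icomp C B f i = f" "icomp C B f' i = f'" "icomp C B i g = g" "icomp C B i g' = g'"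
    using D(13)[OF f] D(13)[OF f'] D(12)[OF g] D(12)[OF g'] fg f'g gg' by (simp_all add: i_def)
  \<comment> \<open>Padding writes \<open>f\<close> as a value of \<open>cmp B\<close>, so that the
    hypothesis \<open>f T f'\<close> becomes a statement about the points \<open>x\<close>,
    \<open>x'\<close> of the object of composable pairs.\<close>
  obtain x where x: "x \<in> hom C Z (Dom C (pairs1 C B))" "pairs1 C B \<cdot> x = f" "pairs2 C B \<cdot> x = i"
    "f = cmp B \<cdot> x" using pair[OF f i] fg si ifi by auto
  obtain x' where x': "x' \<in> hom C Z (Dom C (pairs1 C B))" "pairs1 C B \<cdot> x' = f'"
    "pairs2 C B \<cdot> x' = i" "f' = cmp B \<cdot> x'" using pair[OF f' i] f'g si ifi by auto
  obtain y where y: "y \<in> hom C Z (Dom C (pairs1 C B))" "pairs1 C B \<cdot> y = f" "pairs2 C B \<cdot> y = g"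
    "icomp C B f g = cmp B \<cdot> y" using pair[OF f g] fg by auto
  obtain y' where y': "y' \<in> hom C Z (Dom C (pairs1 C B))" "pairs1 C B \<cdot> y' = f'"
    "pairs2 C B \<cdot> y' = g" "icomp C B f' g = cmp B \<cdot> y'" using pair[OF f' g] f'g by auto
  have 1: "related C T (cmp B \<cdot> y) (cmp B \<cdot> y')"
    by (rule rectangle_shift[OF P(1,2) joint D(9) T x(1) y(1) x'(1) y'(1)])
      (use x x' y y' Tf in auto)
  obtain z where z: "z \<in> hom C Z (Dom C (pairs1 C B))" "pairs1 C B \<cdot> z = i" "pairs2 C B \<cdot> z = g"
    "g = cmp B \<cdot> z" using pair[OF i g] ti ifi by auto
  obtain z' where z': "z' \<in> hom C Z (Dom C (pairs1 C B))" "pairs1 C B \<cdot> z' = i"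
    "pairs2 C B \<cdot> z' = g'" "g' = cmp B \<cdot> z'" using pair[OF i g'] ti gg' ifi by auto
  obtain w where w: "w \<in> hom C Z (Dom C (pairs1 C B))" "pairs1 C B \<cdot> w = f'"
    "pairs2 C B \<cdot> w = g'" "icomp C B f' g' = cmp B \<cdot> w" using pair[OF f' g'] f'g gg' by auto
  \<comment> \<open>In the second rectangle the other factor varies, so the two projections exchange
    their roles.\<close>
  have swapped: "jointly_monic C (pairs2 C B) (pairs1 C B)"
  proof -
    have "Dom C (pairs2 C B) = Dom C (pairs1 C B)" using P(2) by (simp add: hom_def)
    then show ?thesis using joint unfolding jointly_monic_def by auto
  qed
  have 2: "related C T (cmp B \<cdot> y') (cmp B \<cdot> w)"
    by (rule rectangle_shift[OF P(2,1) swapped D(9) T z(1) y'(1) z'(1) w(1)])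
      (use z z' y' w Tg in auto)
  show ?thesis
    using internal_equivalenceD(4)[OF T Comp_hom[OF y(1) D(9)] Comp_hom[OF y'(1) D(9)]
        Comp_hom[OF w(1) D(9)] 1 2] y w by simp
qed

text \<open>Maximality is borrowed from \<open>M\<close>: the legs of any competing relation in the
  fiber form a saturating relation in \<open>C\<close>, hence factor through \<open>M\<close>, and
  the factorization is then lifted back.\<close>

lemma fiber_equ_saturating:
  assumes eq: "equ_saturating_category C" and X: "X \<in> Obj C"
  shows "equ_saturating_category (cat_fiber C X)"
proof (intro equ_saturating_category.intro[OF fiber_finitely_complete[OF X]]
    equ_saturating_category_axioms.intro)
  interpret F: finitely_complete_category "cat_fiber C X" by (rule fiber_finitely_complete[OF X])
  fix U S assume U: "monic (cat_fiber C X) U"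
    and S: "internal_equivalence (cat_fiber C X) (Dom (cat_fiber C X) U) S"
  obtain A u B where U_def: "U = (A, u, B)" by (cases U)
  have uA: "(A, u, B) \<in> Arr (cat_fiber C X)" using U by (simp add: monic_def U_def)
  note u = fiber_arrD[OF uA] note DA = fiber_objD[OF u(1)] note DB = fiber_objD[OF u(2)]
  have uj: "jointly_monic C u u"
    using U fiber_jointly_monic_descends[OF uA uA] by (simp add: F.monic_iff U_def)
  have um: "monic C u" using uj u(3) by (simp add: monic_iff hom_def)
  have du: "Dom C u = imor A" "Cod C u = imor B" using u(3) by (auto simp: hom_def)
  have dU: "Dom (cat_fiber C X) U = A" "Cod (cat_fiber C X) U = B"
    by (simp_all add: U_def fiber_simps)
  note SF = S[unfolded dU]
  obtain R p q where S_def: "S = ((R, p, A), (R, q, A))"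
    and p: "(R, p, A) \<in> Arr (cat_fiber C X)" and q: "(R, q, A) \<in> Arr (cat_fiber C X)"
    and pq: "jointly_monic C p q"
    using fiber_relationE[OF F.internal_equivalenceD(1)[OF SF]] .
  have SC: "internal_equivalence C (imor A) (p, q)"
    using fiber_equivalence_descends[OF p q pq] SF by (simp add: S_def)
  have satC: "T \<in> saturating_relations C u (p, q) \<longleftrightarrow> internal_equivalence C (imor B) T \<and>
      (\<forall>Z. \<forall>a\<in>hom C Z (imor A). \<forall>t\<in>hom C Z (apex C T). fst T \<cdot> t = u \<cdot> a \<longrightarrow>
       (\<exists>b\<in>hom C Z (imor A). snd T \<cdot> t = u \<cdot> b \<and> related C (p, q) a b))" for T
    using saturating_relations_iff[OF um, of "(p, q)" T] internal_equivalenceD(1)[OF SC]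
    by (simp add: du)
  have satF: "T \<in> saturating_relations (cat_fiber C X) U S \<longleftrightarrow>
      internal_equivalence (cat_fiber C X) B T \<and>
      (\<forall>Z. \<forall>a\<in>hom (cat_fiber C X) Z A. \<forall>t\<in>hom (cat_fiber C X) Z (apex (cat_fiber C X) T).
        Comp (cat_fiber C X) (fst T) t = Comp (cat_fiber C X) U a \<longrightarrow>
       (\<exists>b\<in>hom (cat_fiber C X) Z A. Comp (cat_fiber C X) (snd T) t = Comp (cat_fiber C X) U b \<and>
          related (cat_fiber C X) S a b))" for T
    using F.saturating_relations_iff[OF U, of S T] F.internal_equivalenceD(1)[OF SF]
    by (simp add: dU)
  obtain M where M: "M \<in> saturating_relations C u (p, q)"
    and max: "\<And>T'. T' \<in> saturating_relations C u (p, q) \<Longrightarrow> rel_le C T' M"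
    using equ_saturating_category.equ_saturating[OF eq um, of "(p, q)"] SC du by auto
  have ME: "internal_equivalence C (imor B) M"
    and Msat: "\<And>Z a t. \<lbrakk>a \<in> hom C Z (imor A); t \<in> hom C Z (apex C M); fst M \<cdot> t = u \<cdot> a\<rbrakk> \<Longrightarrow>
       \<exists>b\<in>hom C Z (imor A). snd M \<cdot> t = u \<cdot> b \<and> related C (p, q) a b"
    using M satC by blast+
  note ME' = internal_equivalenceD[OF ME]
  have m0: "fst M \<in> hom C (apex C M) (imor B)" and m1: "snd M \<in> hom C (apex C M) (imor B)"
    and mj: "jointly_monic C (fst M) (snd M)"
    using ME'(1) by (auto simp: is_relation_iff)
  \<comment> \<open>\<open>N\<close> is the part of \<open>M\<close> consisting of parallel pairs;
    it becomes the object of arrows of the apex of the largest relation.\<close>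
  obtain N e where e: "e \<in> hom C N (apex C M)"
    and es: "(src B \<cdot> fst M) \<cdot> e = (src B \<cdot> snd M) \<cdot> e"
    and et: "(tgt B \<cdot> fst M) \<cdot> e = (tgt B \<cdot> snd M) \<cdot> e"
    and eu: "\<And>Z a. \<lbrakk>a \<in> hom C Z (apex C M); (src B \<cdot> fst M) \<cdot> a = (src B \<cdot> snd M) \<cdot> a;
      (tgt B \<cdot> fst M) \<cdot> a = (tgt B \<cdot> snd M) \<cdot> a\<rbrakk> \<Longrightarrow> \<exists>!w. w \<in> hom C Z N \<and> e \<cdot> w = a"
    using joint_equalizer_exists[OF Comp_hom[OF m0 DB(6)] Comp_hom[OF m1 DB(6)]
        Comp_hom[OF m0 DB(7)] Comp_hom[OF m1 DB(7)]] by blast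
  define t0 where "t0 = fst M \<cdot> e"
  define t1 where "t1 = snd M \<cdot> e"
  have t0: "t0 \<in> hom C N (imor B)" and t1: "t1 \<in> hom C N (imor B)"
    using Comp_hom[OF e m0] Comp_hom[OF e m1] by (auto simp: t0_def t1_def)
  have st: "src B \<cdot> t0 = src B \<cdot> t1" "tgt B \<cdot> t0 = tgt B \<cdot> t1"
    using es et comp_prefix[OF refl m0 DB(6) e] comp_prefix[OF refl m1 DB(6) e]
      comp_prefix[OF refl m0 DB(7) e] comp_prefix[OF refl m1 DB(7) e] by (simp_all add: t0_def t1_def)
  have d0: "Dom C t0 = N" using t0 by (simp add: hom_def)
  have M_t: "fst M \<cdot> (e \<cdot> x) = t0 \<cdot> x" "snd M \<cdot> (e \<cdot> x) = t1 \<cdot> x" if "x \<in> hom C Z N" for Z x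
    using comp_prefix[OF refl e m0 that] comp_prefix[OF refl e m1 that] by (auto simp: t0_def t1_def)
  have univ: "\<exists>w\<in>hom C Z N. e \<cdot> w = t \<and> t0 \<cdot> w = fst M \<cdot> t \<and> t1 \<cdot> w = snd M \<cdot> t"
    if t: "t \<in> hom C Z (apex C M)" "src B \<cdot> (fst M \<cdot> t) = src B \<cdot> (snd M \<cdot> t)"
      "tgt B \<cdot> (fst M \<cdot> t) = tgt B \<cdot> (snd M \<cdot> t)" for Z t
  proof -
    have "\<exists>!w. w \<in> hom C Z N \<and> e \<cdot> w = t"
      by (rule eu[OF t(1)])
        (use t comp_prefix[OF refl m0 DB(6) t(1)] comp_prefix[OF refl m1 DB(6) t(1)]
          comp_prefix[OF refl m0 DB(7) t(1)] comp_prefix[OF refl m1 DB(7) t(1)] in auto)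
    then show ?thesis using M_t by metis
  qed
  have tj: "jointly_monic C t0 t1"
    unfolding jointly_monic_def d0
  proof (intro allI ballI impI)
    fix Z g h assume g: "g \<in> hom C Z N" and h: "h \<in> hom C Z N"
      and gh: "t0 \<cdot> g = t0 \<cdot> h \<and> t1 \<cdot> g = t1 \<cdot> h"
    have eg: "e \<cdot> g = e \<cdot> h"
      using jointly_monicD[OF mj Comp_hom[OF g e] Comp_hom[OF h e]] M_t[OF g] M_t[OF h] gh by simp
    have "\<exists>!w. w \<in> hom C Z N \<and> e \<cdot> w = e \<cdot> h"
      by (rule eu[OF Comp_hom[OF h e]])
        (use square_prefix[OF es e Comp_hom[OF m0 DB(6)] e Comp_hom[OF m1 DB(6)] h]
          square_prefix[OF et e Comp_hom[OF m0 DB(7)] e Comp_hom[OF m1 DB(7)] h] in auto)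
    then show "g = h" using g h eg by auto
  qed
  have Trel: "related C (t0, t1) x y \<longleftrightarrow>
      related C M x y \<and> src B \<cdot> x = src B \<cdot> y \<and> tgt B \<cdot> x = tgt B \<cdot> y"
    if x: "x \<in> hom C Z (imor B)" for Z x y
  proof
    assume "related C (t0, t1) x y"
    then obtain h where h: "h \<in> hom C Z N" "t0 \<cdot> h = x" "t1 \<cdot> h = y"
      using relatedE[OF _ x, of "(t0, t1)" y] d0 by auto
    show "related C M x y \<and> src B \<cdot> x = src B \<cdot> y \<and> tgt B \<cdot> x = tgt B \<cdot> y"
      using relatedI[OF Comp_hom[OF h(1) e] m0] M_t[OF h(1)]
        square_prefix[OF st(1) t0 DB(6) t1 DB(6) h(1)]
        square_prefix[OF st(2) t0 DB(7) t1 DB(7) h(1)] h by auto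
  next
    assume r: "related C M x y \<and> src B \<cdot> x = src B \<cdot> y \<and> tgt B \<cdot> x = tgt B \<cdot> y"
    then obtain t where t: "t \<in> hom C Z (apex C M)" "fst M \<cdot> t = x" "snd M \<cdot> t = y"
      using relatedE[OF _ x] by blast
    obtain w where "w \<in> hom C Z N" "t0 \<cdot> w = x" "t1 \<cdot> w = y" using univ[OF t(1)] t r by auto
    then show "related C (t0, t1) x y" using relatedI[of w Z "(t0, t1)" "imor B" x y] d0 t0 by simp
  qed
  have Ceq: "internal_equivalence C (imor B) (t0, t1)"
  proof (rule internal_equivalenceI)
    show "is_relation C (imor B) (t0, t1)" using t0 t1 tj d0 by (simp add: is_relation_iff)
  next
    fix Z x assume "x \<in> hom C Z (imor B)"
    then show "related C (t0, t1) x x" using Trel ME'(2) by blast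
  next
    fix Z x y assume "x \<in> hom C Z (imor B)" "y \<in> hom C Z (imor B)" "related C (t0, t1) x y"
    then show "related C (t0, t1) y x" using Trel ME'(3) by metis
  next
    fix Z x y z assume "x \<in> hom C Z (imor B)" "y \<in> hom C Z (imor B)" "z \<in> hom C Z (imor B)"
      "related C (t0, t1) x y" "related C (t0, t1) y z"
    then show "related C (t0, t1) x z" using Trel ME'(4) by metis
  qed
  note CE = internal_equivalenceD[OF Ceq]
  \<comment> \<open>Reflexivity at the identities of \<open>B\<close> supplies the identities of the
    lifted category.\<close>
  obtain i where i: "i \<in> hom C X N" "t0 \<cdot> i = idn B" "t1 \<cdot> i = idn B"
    using relatedE[OF CE(2)[OF DB(8)] DB(8)] d0 by auto
  have "\<exists>L. L \<in> Obj (cat_fiber C X) \<and> imor L = N \<and> (L, t0, B) \<in> Arr (cat_fiber C X) \<and>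
      (L, t1, B) \<in> Arr (cat_fiber C X)"
  proof (rule pair_lift[OF u(2) u(2) t0 t1 st tj i])
    fix Z a b assume ab: "a \<in> hom C Z N" "b \<in> hom C Z N"
      "tgt B \<cdot> (t0 \<cdot> a) = src B \<cdot> (t0 \<cdot> b)" "tgt B \<cdot> (t1 \<cdot> a) = src B \<cdot> (t1 \<cdot> b)"
    note a0 = Comp_hom[OF ab(1) t0] and a1 = Comp_hom[OF ab(1) t1]
      and b0 = Comp_hom[OF ab(2) t0] and b1 = Comp_hom[OF ab(2) t1]
    have r: "related C (t0, t1) (t0 \<cdot> x) (t1 \<cdot> x)" if "x \<in> hom C Z N" for x
      using relatedI[of x Z "(t0, t1)" "imor B"] that d0 t0 by simp
    \<comment> \<open>Since \<open>t0\<close> and \<open>t1\<close> are parallel, mixed pairs are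
      composable as well; the middle corner of the two shifts needs this.\<close>
    have "tgt B \<cdot> (t1 \<cdot> a) = src B \<cdot> (t0 \<cdot> b)" "src B \<cdot> (t0 \<cdot> b) = src B \<cdot> (t1 \<cdot> b)"
      using square_prefix[OF st(2) t0 DB(7) t1 DB(7) ab(1)]
        square_prefix[OF st(1) t0 DB(6) t1 DB(6) ab(2)] ab by auto
    from equivalence_icomp[OF u(2) Ceq a0 a1 b0 b1 ab(3) this r[OF ab(1)] r[OF ab(2)]]
    have "related C (t0, t1) (icomp C B (t0 \<cdot> a) (t0 \<cdot> b)) (icomp C B (t1 \<cdot> a) (t1 \<cdot> b))" .
    from relatedE[OF this icomp_hom(1)[OF DB(2) a0 b0 ab(3)]]
    show "\<exists>c\<in>hom C Z N. t0 \<cdot> c = icomp C B (t0 \<cdot> a) (t0 \<cdot> b) \<and> t1 \<cdot> c = icomp C B (t1 \<cdot> a) (t1 \<cdot> b)"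
      using d0 by auto
  qed
  then obtain L where L: "L \<in> Obj (cat_fiber C X)" "imor L = N"
    and L0: "(L, t0, B) \<in> Arr (cat_fiber C X)" and L1: "(L, t1, B) \<in> Arr (cat_fiber C X)" by blast
  let ?T = "((L, t0, B), (L, t1, B))"
  show "\<exists>T\<in>saturating_relations (cat_fiber C X) U S.
      \<forall>T'\<in>saturating_relations (cat_fiber C X) U S. rel_le (cat_fiber C X) T' T"
  proof (intro bexI[of _ ?T] ballI)
    show "?T \<in> saturating_relations (cat_fiber C X) U S"
      unfolding satF
    proof (intro conjI fiber_equivalence_ascends[OF L0 L1 Ceq] allI ballI impI)
      fix Z a' t' assume "a' \<in> hom (cat_fiber C X) Z A"
        "t' \<in> hom (cat_fiber C X) Z (apex (cat_fiber C X) ?T)"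
        and at': "Comp (cat_fiber C X) (fst ?T) t' = Comp (cat_fiber C X) U a'"
      then obtain a t where a: "a' = (Z, a, A)" "(Z, a, A) \<in> Arr (cat_fiber C X)"
        and t: "t' = (Z, t, L)" "(Z, t, L) \<in> Arr (cat_fiber C X)"
        by (auto simp: fiber_hom_iff fiber_simps)
      have at: "t0 \<cdot> t = u \<cdot> a" using at' by (simp add: a t U_def fiber_simps)
      note a3 = fiber_arrD(3)[OF a(2)] and t3 = fiber_arrD(3)[OF t(2), unfolded L(2)]
      \<comment> \<open>Regarded through \<open>e\<close> as an element of \<open>M\<close>, the
        given element of the restricted relation falls under the saturation of
        \<open>M\<close>.\<close>
      obtain b where b: "b \<in> hom C (imor Z) (imor A)" "t1 \<cdot> t = u \<cdot> b" "related C (p, q) a b"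
        using Msat[OF a3 Comp_hom[OF t3 e]] M_t[OF t3] at by auto
      have "(Z, t1 \<cdot> t, B) \<in> Arr (cat_fiber C X)"
        using F.Comp_hom[of "(Z, t, L)" Z L "(L, t1, B)" B] t L1
        by (simp add: triple_fiber_hom_iff fiber_simps)
      \<comment> \<open>So far \<open>b\<close> is only an arrow of \<open>C\<close>. It is a
        functor because \<open>u \<cdot> b\<close> is one and \<open>u\<close> is monic.\<close>
      then have bA: "(Z, b, A) \<in> Arr (cat_fiber C X)"
        using pair_functoriality_reflected[OF uA uA uj b(1)] b(2) by simp
      have "related (cat_fiber C X) S a' (Z, b, A)"
        using related_fiber_iff[OF p q pq a(2) bA] b(3) by (simp add: S_def a)
      then show "\<exists>b\<in>hom (cat_fiber C X) Z A.
          Comp (cat_fiber C X) (snd ?T) t' = Comp (cat_fiber C X) U b \<and>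
          related (cat_fiber C X) S a' b"
        using bA b(2) by (intro bexI[of _ "(Z, b, A)"])
          (auto simp: t U_def fiber_simps triple_fiber_hom_iff)
    qed
  next
    fix T' assume T': "T' \<in> saturating_relations (cat_fiber C X) U S"
    then have T'E: "internal_equivalence (cat_fiber C X) B T'" unfolding satF by blast
    obtain K k l where T'_def: "T' = ((K, k, B), (K, l, B))"
      and k: "(K, k, B) \<in> Arr (cat_fiber C X)" and l: "(K, l, B) \<in> Arr (cat_fiber C X)"
      and kl: "jointly_monic C k l"
      using fiber_relationE[OF F.internal_equivalenceD(1)[OF T'E]] .
    note k' = fiber_arrD[OF k] and l' = fiber_arrD[OF l]
    have dk: "Dom C k = imor K" using k' by (simp add: hom_def)
    have "(k, l) \<in> saturating_relations C u (p, q)"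
      unfolding satC fst_conv snd_conv dk
    proof (intro conjI allI ballI impI)
      show "internal_equivalence C (imor B) (k, l)"
        using fiber_equivalence_descends[OF k l kl] T'E by (simp add: T'_def)
      \<comment> \<open>The generic element of the competing relation that starts in the subobject.
        Its stage \<open>P\<close> is a category over \<open>X\<close>, so saturation in the fiber
        applies, and the resulting \<open>b\<close> is restricted to arbitrary stages along
        \<open>w\<close>.\<close>
      obtain P x y where x: "(P, x, A) \<in> Arr (cat_fiber C X)" and y: "(P, y, K) \<in> Arr (cat_fiber C X)"
        and pb: "is_pullback C x y u k"
        using fiber_pullback_exists[OF uA k] by blast
      note x' = fiber_arrD[OF x] and y' = fiber_arrD[OF y]
      have dx: "Dom C x = imor P" using x' by (simp add: hom_def)
      note PB = pullbackD[OF pb, unfolded du dk dx]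
      have "Comp (cat_fiber C X) (fst T') (P, y, K) = Comp (cat_fiber C X) U (P, x, A)"
        using PB(3) by (simp add: T'_def U_def fiber_simps)
      moreover have "(P, x, A) \<in> hom (cat_fiber C X) P A"
        "(P, y, K) \<in> hom (cat_fiber C X) P (apex (cat_fiber C X) T')"
        using x y by (auto simp: triple_fiber_hom_iff T'_def fiber_simps)
      ultimately obtain b' where b': "b' \<in> hom (cat_fiber C X) P A"
        "Comp (cat_fiber C X) (snd T') (P, y, K) = Comp (cat_fiber C X) U b'"
        "related (cat_fiber C X) S (P, x, A) b'"
        using T' unfolding satF by blast
      then obtain b where b: "b' = (P, b, A)" "(P, b, A) \<in> Arr (cat_fiber C X)"
        by (auto simp: fiber_hom_iff)
      have lb: "l \<cdot> y = u \<cdot> b" using b'(2) by (simp add: T'_def U_def b fiber_simps)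
      have xb: "related C (p, q) x b"
        using b'(3) related_fiber_iff[OF p q pq x b(2)] by (simp add: S_def b)
      note b3 = fiber_arrD(3)[OF b(2)]
      fix Z a t assume a: "a \<in> hom C Z (imor A)" and t: "t \<in> hom C Z (imor K)"
        and at: "k \<cdot> t = u \<cdot> a"
      obtain w where w: "w \<in> hom C Z (imor P)" "x \<cdot> w = a" "y \<cdot> w = t"
        using PB(4)[OF a t at[symmetric]] by blast
      show "\<exists>b\<in>hom C Z (imor A). l \<cdot> t = u \<cdot> b \<and> related C (p, q) a b"
        using Comp_hom[OF w(1) b3] square_prefix[OF lb y'(3) l'(3) b3 u(3) w(1)]
          related_comp[OF xb x'(3) internal_equivalenceD(1)[OF SC] w(1)] w by auto
    qed
    from max[OF this] obtain h where h: "h \<in> hom C (imor K) (apex C M)" "fst M \<cdot> h = k"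
      "snd M \<cdot> h = l" using dk by (auto simp: rel_le_def)
    \<comment> \<open>Being functors over \<open>X\<close>, \<open>k\<close> and \<open>l\<close>
      have the same source and target, so their factorization \<open>h\<close> through
      \<open>M\<close> lands in the parallel part.\<close>
    obtain w where w: "w \<in> hom C (imor K) (imor L)" "t0 \<cdot> w = k" "t1 \<cdot> w = l"
      using univ[OF h(1)] h k'(4,5) l'(4,5) L(2) by auto
    have "(K, w, L) \<in> Arr (cat_fiber C X)"
      using pair_functoriality_reflected[OF L0 L1 tj w(1)] w k l by simp
    then show "rel_le (cat_fiber C X) T' ?T"
      using w unfolding rel_le_def
      by (intro bexI[of _ "(K, w, L)"]) (auto simp: T'_def fiber_simps triple_fiber_hom_iff)
  qed
qed

end

theorem proposition5p4:
  fixes E :: "('o, 'm) cat" and X :: 'o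
  assumes "gumm_category E"
    and "equ_saturating_category E"
    and "X \<in> Obj E"
  shows "equ_saturating_category (cat_fiber E X)"
  using assms by (rule gumm_category.fiber_equ_saturating)

end
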